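(* Let $M\subset\mathbb{R}^d$ be a compact positively invariant set for the control system $\dot x=\sum_{i=0}^m v_i(t)F^i(x)$ with controls $v\in L^\infty(\mathbb{R}_+,\mathrm{co}(S))$. Suppose that there are only finitely many invariant control sets $C_r\subset M$, $r=1,\dots,l$, and that for all $r$ one has $C_r=\mathrm{cl}(\mathrm{int}\,C_r)$ and $\mathrm{int}\,C_r\subset\mathcal{O}^+(x)$ for every $x\in C_r$. (These assumptions hold in particular if the system is locally accessible on $M$.) Then every invariant measure $\mu$ of the discrete-time process $(\tilde Z_n)_n=(\tilde X_n,\tilde Y_n)_n$ on $M\times E$ satisfies $$\mathrm{supp}\,\mu\subset\bigcup_{r=1}^l C_r\times E.$$
   Context: Setting. $E=\{0,1,\dots,m\}$ is a finite set; for each $i\in E$, $F^i:\mathbb{R}^d\to\mathbb{R}^d$ is a bounded $C^\infty$ vector field with solution map $\Phi^i(t,x)$, $t\ge 0$. $M\subset\mathbb{R}^d$ is a (nonempty) compact set with $\Phi^i(t,x)\in M$ for all $t\ge 0$, $x\in M$, $i\in E$. Control system. $\mathrm{co}(S)=\{v\in\mathbb{R}^{m+1}: \sum_{i=0}^m v_i=1,\ v_i\in[0,1]\}$ and $L^\infty(\mathbb{R}_+,\mathrm{co}(S))$ is the set of $L^\infty$ functions on $\mathbb{R}_+=[0,\infty)$ with values in $\mathrm{co}(S)$. For $x\in\mathbb{R}^d$ and $v\in L^\infty(\mathbb{R}_+,\mathrm{co}(S))$, $\varphi(t,x,v)$, $t\ge0$, is the solution of $\dot x=\sum_{i=0}^m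 v_i(t)F^i(x)$ with $\varphi(0,x,v)=x$. $M$ is positively invariant if $\varphi(t,x,v)\in M$ for all $x\in M$, $t\ge 0$ and all controls $v$. For $T>0$, $\mathcal{O}^+_{\le T}(x)=\{\varphi(t,x,v): t\in[0,T],\ v \text{ a control}\}$, $\mathcal{O}^-_{\le T}(x)=\{y\in\mathbb{R}^d: x=\varphi(t,y,v)\text{ for some }t\in[0,T]\text{ and some control }v\}$, and $\mathcal{O}^\pm(x)=\bigcup_{T>0}\mathcal{O}^\pm_{\le T}(x)$. The system is locally accessible on a set $A\subset\mathbb{R}^d$ if for every $x\in A$, every $T>0$ and every neighborhood $N$ of $x$ one has $\mathrm{int}\,\mathcal{O}^+_{\le T}(x)\cap N\ne\emptyset$ and $\mathrm{int}\,\mathcal{O}^-_{\le T}(x)\cap N\neq\emptyset$. A control set is a nonempty set $D\subset\mathbb{R}^d$ such that (i) for every $x\in D$ there is a control $v$ with $\varphi(t,x,v)\in D$ for all $t\ge0$; (ii) $D\subset\mathrm{cl}\,\mathcal{O}^+(x)$ for every $x\in D$; (iii) $D$ is maximal (with respect to inclusion) with properties (i) and (ii). An invariant control set is a control set $C$ with $\mathrm{cl}\,C=\mathrm{cl}\,\mathcal{O}^+(x)$ for all $x\in C$. Here $\mathrm{cl}$ and $\mathrm{int}$ are closure and interior in $\mathbb{R}^d$. Process. $x\mapsto Q(x)=(Q(x,i,j))_{i,j\in E}$ is continuous on $\mathbb{R}^d$, each $Q(x)$ being an irreducible aperiodic Markov transition matrix, i.e. for each $x$ there is $n_x\in\mathbb{N}$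 with $Q^{n_x}(x,i,j)>0$ for all $i,j\in E$. $(N_t)_{t\ge0}$ is a homogeneous Poisson process with intensity $\lambda>0$, jump times $(T_n)_{n\ge 0}$ ($T_0=0$), and $U_n=T_n-T_{n-1}$, $n\ge1$. $\tilde Z_0\in M\times E$ is independent of $(N_t)$. The Markov chain $\tilde Z_n=(\tilde X_n,\tilde Y_n)$ on $M\times E$ is defined recursively by $\tilde X_{n+1}=\Phi^{\tilde Y_n}(U_{n+1},\tilde X_n)$ and $\mathbb{P}[\tilde Y_{n+1}=j\mid \tilde X_{n+1},\tilde Y_n=i]=Q(\tilde X_{n+1},i,j)$. Measures are Borel probability measures on $M\times E$; the support is the closed set of points all of whose neighborhoods have positive measure. *)

theory Defs
  imports "HOL-Probability.Probability"
begin

section \<open>Smooth vector fields and their flows\<close>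

text \<open>Since the domain is finite-dimensional, continuity of all directional derivatives of order
  up to \<open>k\<close> is the usual notion of class \<open>C^k\<close>.\<close>

primrec C_k :: "nat \<Rightarrow> ('a::euclidean_space \<Rightarrow> 'a) \<Rightarrow> bool" where
  "C_k 0 f \<longleftrightarrow> continuous_on UNIV f"
| "C_k (Suc k) f \<longleftrightarrow> (\<forall>x. f differentiable (at x)) \<and>
     (\<forall>h. C_k k (\<lambda>x. frechet_derivative f (at x) h))"

definition C_infinity :: "('a::euclidean_space \<Rightarrow> 'a) \<Rightarrow> bool" where
  "C_infinity f \<longleftrightarrow> (\<forall>k. C_k k f)"

text \<open>The solution map of \<open>x' = f(x)\<close> for times \<open>t \<ge> 0\<close>. For bounded smooth \<open>f\<close> the solution on
  \<open>[0,\<infinity>)\<close> exists and is unique, so the choice operator picks it; values at \<open>t < 0\<close> are meaningless.\<close>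

definition flow :: "('a::euclidean_space \<Rightarrow> 'a) \<Rightarrow> real \<Rightarrow> 'a \<Rightarrow> 'a" where
  "flow f t x = (SOME \<xi>. \<xi> 0 = x \<and>
     (\<forall>s\<ge>0. (\<xi> has_vector_derivative f (\<xi> s)) (at s within {0..}))) t"


section \<open>The control system\<close>

text \<open>The index set \<open>E = {0,...,m}\<close> is \<open>{..m}\<close>, and vectors in \<open>\<real>^(m+1)\<close> are functions on
  \<open>{..m}\<close>, extended by \<open>undefined\<close>.\<close>

definition co_S :: "nat \<Rightarrow> (nat \<Rightarrow> real) set" where
  "co_S m = {v \<in> {..m} \<rightarrow>\<^sub>E {0..1}. (\<Sum>i\<le>m. v i) = 1}"

text \<open>Representatives of the elements of \<open>L^\<infinity>([0,\<infinity>), co(S))\<close>; changing \<open>v\<close> on a null set does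
  not affect the solutions below, so no quotient is taken.\<close>

definition controls :: "nat \<Rightarrow> (real \<Rightarrow> nat \<Rightarrow> real) set" where
  "controls m = {v. (\<forall>t\<ge>0. v t \<in> co_S m) \<and>
     (\<forall>i\<le>m. (\<lambda>t. v t i) \<in> borel_measurable (lebesgue_on {0..}))}"

text \<open>Solutions for measurable controls are meant in the sense of Caratheodory, i.e. as solutions of
  the integral equation (at \<open>t = 0\<close> it gives \<open>\<xi> 0 = x\<close>).\<close>

definition solves_control_system ::
  "nat \<Rightarrow> (nat \<Rightarrow> 'a \<Rightarrow> 'a) \<Rightarrow> 'a \<Rightarrow> (real \<Rightarrow> nat \<Rightarrow> real) \<Rightarrow> (real \<Rightarrow> 'a::euclidean_space) \<Rightarrow> bool" where
  "solves_control_system m F x v \<xi> \<longleftrightarrow> continuous_on {0..} \<xi> \<and>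
     (\<forall>t\<ge>0. ((\<lambda>s. \<Sum>i\<le>m. v s i *\<^sub>R F i (\<xi> s)) has_integral (\<xi> t - x)) {0..t})"

definition phi ::
  "nat \<Rightarrow> (nat \<Rightarrow> 'a \<Rightarrow> 'a) \<Rightarrow> real \<Rightarrow> 'a \<Rightarrow> (real \<Rightarrow> nat \<Rightarrow> real) \<Rightarrow> 'a::euclidean_space" where
  "phi m F t x v = (SOME \<xi>. solves_control_system m F x v \<xi>) t"

definition positively_invariant ::
  "nat \<Rightarrow> (nat \<Rightarrow> 'a \<Rightarrow> 'a) \<Rightarrow> 'a::euclidean_space set \<Rightarrow> bool" where
  "positively_invariant m F A \<longleftrightarrow> (\<forall>x\<in>A. \<forall>t\<ge>0. \<forall>v\<in>controls m. phi m F t x v \<in> A)"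

definition orbit_pos_upto ::
  "nat \<Rightarrow> (nat \<Rightarrow> 'a \<Rightarrow> 'a) \<Rightarrow> real \<Rightarrow> 'a \<Rightarrow> 'a::euclidean_space set" where
  "orbit_pos_upto m F T x = {phi m F t x v | t v. t \<in> {0..T} \<and> v \<in> controls m}"

definition orbit_neg_upto ::
  "nat \<Rightarrow> (nat \<Rightarrow> 'a \<Rightarrow> 'a) \<Rightarrow> real \<Rightarrow> 'a \<Rightarrow> 'a::euclidean_space set" where
  "orbit_neg_upto m F T x = {y. \<exists>t\<in>{0..T}. \<exists>v\<in>controls m. x = phi m F t y v}"

definition orbit_pos ::
  "nat \<Rightarrow> (nat \<Rightarrow> 'a \<Rightarrow> 'a) \<Rightarrow> 'a \<Rightarrow> 'a::euclidean_space set" where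
  "orbit_pos m F x = (\<Union>T\<in>{0<..}. orbit_pos_upto m F T x)"

definition locally_accessible_on ::
  "nat \<Rightarrow> (nat \<Rightarrow> 'a \<Rightarrow> 'a) \<Rightarrow> 'a::euclidean_space set \<Rightarrow> bool" where
  "locally_accessible_on m F A \<longleftrightarrow> (\<forall>x\<in>A. \<forall>T>0. \<forall>U. open U \<and> x \<in> U \<longrightarrow>
     interior (orbit_pos_upto m F T x) \<inter> U \<noteq> {} \<and>
     interior (orbit_neg_upto m F T x) \<inter> U \<noteq> {})"

text \<open>Properties (i) and (ii) in the definition of a control set.\<close>

definition controlled_invariant_approx_controllable ::
  "nat \<Rightarrow> (nat \<Rightarrow> 'a \<Rightarrow> 'a) \<Rightarrow> 'a::euclidean_space set \<Rightarrow> bool" where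
  "controlled_invariant_approx_controllable m F D \<longleftrightarrow>
     (\<forall>x\<in>D. \<exists>v\<in>controls m. \<forall>t\<ge>0. phi m F t x v \<in> D) \<and>
     (\<forall>x\<in>D. D \<subseteq> closure (orbit_pos m F x))"

definition control_set ::
  "nat \<Rightarrow> (nat \<Rightarrow> 'a \<Rightarrow> 'a) \<Rightarrow> 'a::euclidean_space set \<Rightarrow> bool" where
  "control_set m F D \<longleftrightarrow> D \<noteq> {} \<and> controlled_invariant_approx_controllable m F D \<and>
     (\<forall>D'. controlled_invariant_approx_controllable m F D' \<and> D \<subseteq> D' \<longrightarrow> D' = D)"

definition invariant_control_set ::
  "nat \<Rightarrow> (nat \<Rightarrow> 'a \<Rightarrow> 'a) \<Rightarrow> 'a::euclidean_space set \<Rightarrow> bool" where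
  "invariant_control_set m F C \<longleftrightarrow> control_set m F C \<and>
     (\<forall>x\<in>C. closure C = closure (orbit_pos m F x))"

definition invariant_control_sets_in ::
  "nat \<Rightarrow> (nat \<Rightarrow> 'a \<Rightarrow> 'a) \<Rightarrow> 'a set \<Rightarrow> 'a::euclidean_space set set" where
  "invariant_control_sets_in m F M = {C. invariant_control_set m F C \<and> C \<subseteq> M}"


section \<open>The piecewise deterministic process\<close>

primrec matrix_power :: "nat \<Rightarrow> (nat \<Rightarrow> nat \<Rightarrow> real) \<Rightarrow> nat \<Rightarrow> nat \<Rightarrow> nat \<Rightarrow> real" where
  "matrix_power m A 0 = (\<lambda>i j. if i = j then 1 else 0)"
| "matrix_power m A (Suc n) = (\<lambda>i j. \<Sum>k\<le>m. matrix_power m A n i k * A k j)"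

definition transition_matrix :: "nat \<Rightarrow> (nat \<Rightarrow> nat \<Rightarrow> real) \<Rightarrow> bool" where
  "transition_matrix m A \<longleftrightarrow> (\<forall>i\<le>m. \<forall>j\<le>m. 0 \<le> A i j) \<and> (\<forall>i\<le>m. (\<Sum>j\<le>m. A i j) = 1)"

definition irreducible_aperiodic :: "nat \<Rightarrow> (nat \<Rightarrow> nat \<Rightarrow> real) \<Rightarrow> bool" where
  "irreducible_aperiodic m A \<longleftrightarrow> (\<exists>n. \<forall>i\<le>m. \<forall>j\<le>m. 0 < matrix_power m A n i j)"

text \<open>By monotonicity of the paths the truncated subtraction on \<^typ>\<open>nat\<close> is the true increment.\<close>

definition poisson_process :: "'w measure \<Rightarrow> real \<Rightarrow> (real \<Rightarrow> 'w \<Rightarrow> nat) \<Rightarrow> bool" where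
  "poisson_process P rate N \<longleftrightarrow>
     (\<forall>t\<ge>0. N t \<in> measurable P (count_space UNIV)) \<and>
     (\<forall>\<omega>\<in>space P. N 0 \<omega> = 0 \<and> mono_on {0..} (\<lambda>t. N t \<omega>) \<and>
        (\<forall>t\<ge>0. continuous (at_right t) (\<lambda>s. N s \<omega>))) \<and>
     (\<forall>s\<ge>0. \<forall>t>s. distr P (count_space UNIV) (\<lambda>\<omega>. N t \<omega> - N s \<omega>) =
        measure_pmf (poisson_pmf (rate * (t - s)))) \<and>
     (\<forall>(n::nat) (\<tau>::nat \<Rightarrow> real). 0 \<le> \<tau> 0 \<and> mono \<tau> \<longrightarrow>
        prob_space.indep_vars P (\<lambda>_. count_space UNIV)
          (\<lambda>k \<omega>. N (\<tau> (Suc k)) \<omega> - N (\<tau> k) \<omega>) {..<n})"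

definition jump_time :: "(real \<Rightarrow> 'w \<Rightarrow> nat) \<Rightarrow> nat \<Rightarrow> 'w \<Rightarrow> real" where
  "jump_time N n \<omega> = Inf {t. 0 \<le> t \<and> n \<le> N t \<omega>}"

definition interjump_time :: "(real \<Rightarrow> 'w \<Rightarrow> nat) \<Rightarrow> nat \<Rightarrow> 'w \<Rightarrow> real" where
  "interjump_time N n \<omega> = jump_time N n \<omega> - jump_time N (n - 1) \<omega>"

definition state_space :: "nat \<Rightarrow> 'a::euclidean_space set \<Rightarrow> ('a \<times> nat) measure" where
  "state_space m M = restrict_space borel (M \<times> {..m})"

definition path_space :: "(real \<Rightarrow> nat) measure" where
  "path_space = Pi\<^sub>M {0..} (\<lambda>_. count_space UNIV)"

definition counting_path :: "(real \<Rightarrow> 'w \<Rightarrow> nat) \<Rightarrow> 'w \<Rightarrow> real \<Rightarrow> nat" where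
  "counting_path N \<omega> = (\<lambda>t\<in>{0..}. N t \<omega>)"

text \<open>The information available when the mark \<open>Y (n+1)\<close> is drawn: the Poisson process and
  \<open>Z 0, ..., Z n\<close> (these determine \<open>X (n+1)\<close> almost surely).\<close>

definition past_algebra ::
  "nat \<Rightarrow> 'a::euclidean_space set \<Rightarrow> 'w measure \<Rightarrow> (real \<Rightarrow> 'w \<Rightarrow> nat) \<Rightarrow> (nat \<Rightarrow> 'w \<Rightarrow> 'a \<times> nat) \<Rightarrow>
   nat \<Rightarrow> 'w measure" where
  "past_algebra m M P N Z n = vimage_algebra (space P)
     (\<lambda>\<omega>. (\<lambda>k\<in>{..n}. Z k \<omega>, counting_path N \<omega>)) (Pi\<^sub>M {..n} (\<lambda>_. state_space m M) \<Otimes>\<^sub>M path_space)"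

text \<open>The recursion for \<open>X (n+1)\<close> is only required almost surely, because on the null set of bounded
  Poisson paths some jump times are infinite and \<^const>\<open>jump_time\<close> is meaningless.

  The conditional law of \<open>Y (n+1)\<close> is \<open>Q (X (n+1)) (Y n)\<close> given the whole past. By the tower
  property this implies the same formula for conditioning on \<open>(X (n+1), Y n)\<close> only; conditioning on
  the past is what makes \<open>Z\<close> a Markov chain.\<close>

definition switching_chain ::
  "nat \<Rightarrow> (nat \<Rightarrow> 'a \<Rightarrow> 'a) \<Rightarrow> ('a \<Rightarrow> nat \<Rightarrow> nat \<Rightarrow> real) \<Rightarrow> real \<Rightarrow> 'a::euclidean_space set \<Rightarrow>
   'w measure \<Rightarrow> (real \<Rightarrow> 'w \<Rightarrow> nat) \<Rightarrow> (nat \<Rightarrow> 'w \<Rightarrow> 'a \<times> nat) \<Rightarrow> bool" where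
  "switching_chain m F Q rate M P N Z \<longleftrightarrow>
     prob_space P \<and> poisson_process P rate N \<and>
     (\<forall>n. Z n \<in> measurable P (state_space m M)) \<and>
     prob_space.indep_set P
       (sets (vimage_algebra (space P) (Z 0) (state_space m M)))
       (sets (vimage_algebra (space P) (counting_path N) path_space)) \<and>
     (\<forall>n. AE \<omega> in P. fst (Z (Suc n) \<omega>) =
        flow (F (snd (Z n \<omega>))) (interjump_time N (Suc n) \<omega>) (fst (Z n \<omega>))) \<and>
     (\<forall>n. \<forall>j\<le>m. AE \<omega> in P.
        real_cond_exp P (past_algebra m M P N Z n) (indicator {\<omega>. snd (Z (Suc n) \<omega>) = j}) \<omega> =
        Q (fst (Z (Suc n) \<omega>)) (snd (Z n \<omega>)) j)"

text \<open>A measure is invariant for the chain if the chain started from it is stationary; here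
  \<open>(P, N, Z)\<close> is a realization of the chain with initial law \<open>\<mu>\<close>.\<close>

definition invariant_measure ::
  "nat \<Rightarrow> (nat \<Rightarrow> 'a \<Rightarrow> 'a) \<Rightarrow> ('a \<Rightarrow> nat \<Rightarrow> nat \<Rightarrow> real) \<Rightarrow> real \<Rightarrow> 'a::euclidean_space set \<Rightarrow>
   'w measure \<Rightarrow> (real \<Rightarrow> 'w \<Rightarrow> nat) \<Rightarrow> (nat \<Rightarrow> 'w \<Rightarrow> 'a \<times> nat) \<Rightarrow> ('a \<times> nat) measure \<Rightarrow> bool" where
  "invariant_measure m F Q rate M P N Z \<mu> \<longleftrightarrow>
     switching_chain m F Q rate M P N Z \<and> (\<forall>n. distr P (state_space m M) (Z n) = \<mu>)"

text \<open>Neighbourhoods are relative to the space of the measure.\<close>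

definition supp :: "'b::topological_space measure \<Rightarrow> 'b set" where
  "supp \<mu> = {z \<in> space \<mu>. \<forall>U. open U \<and> z \<in> U \<longrightarrow> 0 < emeasure \<mu> (U \<inter> space \<mu>)}"

end

theory Submission
  imports Defs
begin

text \<open>Stationarity gives \<open>P (Z 0 \<in> A) = P (Z 1 \<in> A)\<close>, so the absorbing set
  \<open>A = (\<Union>r. C r) \<times> E\<close> is almost surely not entered from outside. Hence the set of states
  that have a neighbourhood without mass outside \<open>A\<close> is closed under predecessors of the chain:
  from near a predecessor of such a state the chain reaches its neighbourhood with positive probability.
  As \<open>Q\<close> is irreducible and holding times may be arbitrarily short, the points of \<open>M\<close> lacking
  this property for some mark form a compact set that is invariant under every single flow. By relaxation
  it is then invariant under all controls, so if it were nonempty it would contain an invariant control set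
  (the closure of the orbit of a point, by Zorn's lemma), although the nonempty interiors of the
  \<open>C r\<close> consist of points having the property.

  Under local accessibility orbits have interior points near their starting point. This makes invariant
  control sets closed and regular, and gives each point of \<open>M\<close> a neighbourhood which meets at most
  one of them.\<close>

section \<open>The Caratheodory initial value problem\<close>

text \<open>The chain moves only along single flows for random times, whereas invariant control sets
  concern all measurable controls. No path of the chain is steered towards the sets
  \<open>C r\<close> and no hitting probability is estimated: the set where a local property fails
  is shown to be invariant. One transition suffices for this, since by stationarity
  \<open>Z 1\<close> has the law of \<open>Z 0\<close>; only \<open>Z 0\<close>, \<open>Z 1\<close>
  and the first jump time occur. The property is an open condition, so a null neighbourhood of the
  arrival state pulls back to a neighbourhood of the starting state, and the failure set in
  \<open>M\<close> is closed. Demanding the property for all marks turns a set of states into a set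
  of points, to which relaxation applies. Since \<open>flow\<close> and \<open>phi\<close> are
  defined by choice, nothing can be said about them before existence and uniqueness are known. The
  fields are Lipschitz only on balls; the global speed bound \<open>B\<close> compensates for this,
  as a trajectory of duration \<open>T\<close> stays within distance \<open>B * T\<close> of its
  start.\<close>

lemma integral_exp_real:
  fixes c t :: real
  assumes "c \<noteq> 0" "0 \<le> t"
  shows "((\<lambda>s. exp (c * s)) has_integral (exp (c * t) - 1) / c) {0..t}"
proof -
  have "((\<lambda>s. exp (c * s)) has_integral exp (c * t) / c - exp (c * 0) / c) {0..t}"
    using assms by (intro fundamental_theorem_of_calculus)
      (auto intro!: derivative_eq_intros simp flip: has_real_derivative_iff_has_vector_derivative)
  then show ?thesis by (simp add: diff_divide_distrib)
qed

text \<open>The factor 2 is harmless and allows a proof by maximising \<open>exp (-2 L t) u t\<close>.\<close>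

lemma gronwall_integral_inequality:
  fixes u :: "real \<Rightarrow> real"
  assumes cont: "continuous_on {0..T} u" and "0 \<le> a" and L: "0 < L"
    and ineq: "\<And>t. t \<in> {0..T} \<Longrightarrow> u t \<le> a + L * integral {0..t} u"
    and t: "t \<in> {0..T}"
  shows "u t \<le> 2 * a * exp (2 * L * t)"
proof -
  define w where "w s = exp (- (2 * L * s)) * u s" for s
  have "continuous_on {0..T} w"
    unfolding w_def using cont by (intro continuous_intros)
  then obtain \<sigma> where \<sigma>: "\<sigma> \<in> {0..T}" and max: "\<And>s. s \<in> {0..T} \<Longrightarrow> w s \<le> w \<sigma>"
    using continuous_attains_sup[of "{0..T}" w] t by auto
  have ule: "u s \<le> w \<sigma> * exp (2 * L * s)" if "s \<in> {0..T}" for s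
    using max[OF that] by (simp add: w_def exp_minus field_simps)
  have "integral {0..\<sigma>} u \<le> w \<sigma> * ((exp (2 * L * \<sigma>) - 1) / (2 * L))"
  proof (rule has_integral_le)
    show "(u has_integral integral {0..\<sigma>} u) {0..\<sigma>}"
      using \<sigma> by (intro integrable_integral integrable_continuous_interval continuous_on_subset[OF cont]) auto
    show "((\<lambda>s. w \<sigma> * exp (2 * L * s)) has_integral w \<sigma> * ((exp (2 * L * \<sigma>) - 1) / (2 * L))) {0..\<sigma>}"
      using \<sigma> L by (intro has_integral_mult_right integral_exp_real) auto
    show "u s \<le> w \<sigma> * exp (2 * L * s)" if "s \<in> {0..\<sigma>}" for s
      using ule that \<sigma> by auto
  qed
  then have "L * integral {0..\<sigma>} u \<le> L * (w \<sigma> * ((exp (2 * L * \<sigma>) - 1) / (2 * L)))"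
    using L by (intro mult_left_mono) auto
  also have "\<dots> = w \<sigma> * (exp (2 * L * \<sigma>) - 1) / 2"
    \<comment> \<open>The exponent \<open>2 * L\<close> against the factor \<open>L\<close> leaves a
      factor 1/2, so half of the exponential term can be absorbed on the left.\<close>
    using L by (simp add: field_simps)
  finally have "u \<sigma> \<le> a + w \<sigma> * (exp (2 * L * \<sigma>) - 1) / 2"
    using ineq[OF \<sigma>] by linarith
  moreover have "u \<sigma> = w \<sigma> * exp (2 * L * \<sigma>)"
    by (simp add: w_def exp_minus field_simps)
  ultimately have "w \<sigma> * exp (2 * L * \<sigma>) + w \<sigma> \<le> 2 * a"
    by (simp add: field_simps)
  \<comment> \<open>A negative maximum needs no estimate, because \<open>a\<close> is
    nonnegative.\<close>
  moreover have "w \<sigma> \<le> w \<sigma> * exp (2 * L * \<sigma>) + w \<sigma>" if "0 \<le> w \<sigma>"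
    using that by simp
  ultimately have "w \<sigma> \<le> 2 * a"
    using \<open>0 \<le> a\<close> by linarith
  then have "w \<sigma> * exp (2 * L * t) \<le> 2 * a * exp (2 * L * t)"
    by (intro mult_right_mono) auto
  then show ?thesis
    using ule[OF t] by linarith
qed

text \<open>Picard iteration is a contraction for the norm \<open>sup exp (-2 L t) |\<xi> t|\<close>.\<close>

lemma global_caratheodory_solution:
  fixes g :: "real \<Rightarrow> 'a::euclidean_space \<Rightarrow> 'a"
  assumes L: "0 < L"
    and bound: "\<And>s y. 0 \<le> s \<Longrightarrow> norm (g s y) \<le> B"
    and lip: "\<And>s y z. 0 \<le> s \<Longrightarrow> norm (g s y - g s z) \<le> L * norm (y - z)"
    and int: "\<And>\<xi> t. continuous_on {0..} \<xi> \<Longrightarrow> 0 \<le> t \<Longrightarrow> (\<lambda>s. g s (\<xi> s)) integrable_on {0..t}"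
  shows "\<exists>\<xi>. continuous_on {0..} \<xi> \<and>
           (\<forall>t\<ge>0. ((\<lambda>s. g s (\<xi> s)) has_integral (\<xi> t - x)) {0..t})"
proof -
  define c where "c = 2 * L"
  have c: "0 < c" using L by (simp add: c_def)
  have "0 \<le> B" using bound[of 0 0] norm_ge_zero order_trans by blast
  \<comment> \<open>The unknown is \<open>h s = exp (- c s) \<xi> s\<close>, so the weighted norm of
    \<xi> is the plain sup norm of bounded continuous functions. These live on all of the real line,
    hence the truncation \<open>max 0 t\<close> in \<open>K\<close>.\<close>
  define J where "J h t = integral {0..t} (\<lambda>s. g s (exp (c * s) *\<^sub>R h s))" for h :: "real \<Rightarrow> 'a" and t
  define K where "K h t = exp (- (c * max 0 t)) *\<^sub>R (x + J h (max 0 t))" for h :: "real \<Rightarrow> 'a" and t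
  have intg: "(\<lambda>s. g s (exp (c * s) *\<^sub>R h s)) integrable_on {0..t}"
    if "continuous_on UNIV h" "0 \<le> t" for h :: "real \<Rightarrow> 'a" and t
    using that by (intro int continuous_intros) (auto intro: continuous_on_subset)
  have contJ: "continuous_on {0..} (J h)" if h: "continuous_on UNIV h" for h
  proof -
    have "isCont (\<lambda>t. J h (max 0 t)) s" for s
    proof -
      let ?T = "\<bar>s\<bar> + 1"
      have "continuous_on {0..?T} (J h)"
        unfolding J_def by (intro indefinite_integral_continuous_1 intg h) auto
      then have "continuous_on {-?T<..<?T} (\<lambda>t. J h (max 0 t))"
        by (rule continuous_on_compose2) (auto intro!: continuous_intros)
      then show ?thesis
        by (rule continuous_on_interior) auto
    qed
    then have "continuous_on {0..} (\<lambda>t. J h (max 0 t))"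
      by (simp add: continuous_at_imp_continuous_on)
    then show ?thesis
      by (rule continuous_on_eq) (auto simp: max_def)
  qed
  have contK: "continuous_on UNIV (K h)" if h: "continuous_on UNIV h" for h
    unfolding K_def
    by (intro continuous_intros continuous_on_compose2[OF contJ[OF h]]) auto
  have normJ: "norm (J h t) \<le> B * t" if "continuous_on UNIV h" "0 \<le> t" for h t
    using has_integral_bound[of B _ "J h t" 0 t] intg[OF that] \<open>0 \<le> B\<close> bound that
    by (auto simp: J_def integrable_integral)
  \<comment> \<open>The integral grows at most like \<open>B * t\<close>, and the weight beats this
    because \<open>s * exp (- s) \<le> 1\<close>; thus \<open>K\<close> produces bounded
    functions.\<close>
  have boundK: "norm (K h t) \<le> norm x + B / c" if "continuous_on UNIV h" for h t
  proof -
    let ?t = "max 0 t"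
    have "norm (K h t) \<le> exp (- (c * ?t)) * (norm x + B * ?t)"
      unfolding K_def using normJ[OF that, of ?t]
      by (auto intro!: mult_left_mono order_trans[OF norm_triangle_ineq])
    also have "\<dots> = exp (- (c * ?t)) * norm x + B / c * (exp (- (c * ?t)) * (c * ?t))"
      using c by (simp add: field_simps)
    also have "\<dots> \<le> 1 * norm x + B / c * 1"
    proof (intro add_mono mult_mono mult_right_mono mult_left_mono)
      have "c * ?t \<le> exp (c * ?t)"
        using exp_ge_add_one_self[of "c * ?t"] by linarith
      then show "exp (- (c * ?t)) * (c * ?t) \<le> 1"
        by (simp add: exp_minus field_simps)
    qed (use \<open>0 \<le> B\<close> c in auto)
    finally show ?thesis by simp
  qed
  define \<Psi> where "\<Psi> h = Bcontfun (K (apply_bcontfun h))" for h :: "real \<Rightarrow>\<^sub>C 'a"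
  have \<Psi>: "apply_bcontfun (\<Psi> h) = K (apply_bcontfun h)" for h
    unfolding \<Psi>_def
    by (intro Bcontfun_inverse bcontfun_normI[where b = "norm x + B / c"] contK boundK) auto
  have "dist (\<Psi> h) (\<Psi> k) \<le> 1/2 * dist h k" for h k
  proof (rule dist_bound)
    fix t :: real
    let ?t = "max 0 t"
    let ?D = "dist h k"
    have "norm (J h ?t - J k ?t) \<le> L * ?D * ((exp (c * ?t) - 1) / c)"
    proof -
      have ih: "(\<lambda>s. g s (exp (c * s) *\<^sub>R h s)) integrable_on {0..?t}"
        and ik: "(\<lambda>s. g s (exp (c * s) *\<^sub>R k s)) integrable_on {0..?t}"
        by (auto intro!: intg)
      have "norm (g s (exp (c * s) *\<^sub>R h s) - g s (exp (c * s) *\<^sub>R k s)) \<le> L * ?D * exp (c * s)"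
        if "s \<in> {0..?t}" for s
      proof -
        have "norm (g s (exp (c * s) *\<^sub>R h s) - g s (exp (c * s) *\<^sub>R k s))
            \<le> L * norm (exp (c * s) *\<^sub>R h s - exp (c * s) *\<^sub>R k s)"
          using that by (intro lip) auto
        also have "\<dots> = L * exp (c * s) * dist (h s) (k s)"
          by (simp add: dist_norm flip: scaleR_diff_right)
        also have "\<dots> \<le> L * exp (c * s) * ?D"
          using L by (intro mult_left_mono dist_bounded) auto
        finally show ?thesis by (simp add: mult_ac)
      qed
      then have "norm (integral {0..?t} (\<lambda>s. g s (exp (c * s) *\<^sub>R h s) - g s (exp (c * s) *\<^sub>R k s)))
          \<le> integral {0..?t} (\<lambda>s. L * ?D * exp (c * s))"
        by (intro Henstock_Kurzweil_Integration.integral_norm_bound_integral integrable_diff ih ik)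
           (auto intro!: integrable_continuous_interval continuous_intros)
      also have "\<dots> = L * ?D * ((exp (c * ?t) - 1) / c)"
        using c by (intro integral_unique has_integral_mult_right integral_exp_real) auto
      finally show ?thesis
        using ih ik by (simp add: J_def integral_diff)
    qed
    then have "exp (- (c * ?t)) * norm (J h ?t - J k ?t)
        \<le> exp (- (c * ?t)) * (L * ?D * ((exp (c * ?t) - 1) / c))"
      by (intro mult_left_mono) auto
    \<comment> \<open>The choice \<open>c = 2 * L\<close> makes the contraction constant
      1/2.\<close>
    also have "\<dots> = 1/2 * ?D * (1 - exp (- (c * ?t)))"
      using L by (simp add: c_def exp_minus field_simps)
    also have "\<dots> \<le> 1/2 * ?D"
      by (intro mult_right_le_one_le) (auto simp: c less_imp_le)
    finally show "dist (\<Psi> h t) (\<Psi> k t) \<le> 1/2 * ?D"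
      by (simp add: \<Psi> K_def dist_norm flip: scaleR_diff_right)
  qed
  then obtain h where h: "\<Psi> h = h"
    using banach_fix_type[of "1/2" \<Psi>] by auto
  define \<xi> where "\<xi> t = x + J h t" for t
  have \<xi>: "exp (c * t) *\<^sub>R h t = \<xi> t" if "0 \<le> t" for t
  proof -
    have "h t = exp (- (c * t)) *\<^sub>R \<xi> t"
      using arg_cong[OF h, of "\<lambda>f. apply_bcontfun f t"] that by (simp add: \<Psi> K_def \<xi>_def max_def)
    then show ?thesis by (simp add: exp_minus)
  qed
  have "((\<lambda>s. g s (\<xi> s)) has_integral (\<xi> t - x)) {0..t}" if "0 \<le> t" for t
  proof (rule has_integral_eq[rotated])
    show "((\<lambda>s. g s (exp (c * s) *\<^sub>R h s)) has_integral (\<xi> t - x)) {0..t}"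
      using intg[of h t] that by (simp add: \<xi>_def J_def integrable_integral)
  qed (use \<xi> in auto)
  moreover have "continuous_on {0..} \<xi>"
    unfolding \<xi>_def by (intro continuous_intros contJ) auto
  ultimately show ?thesis by blast
qed

section \<open>Controls\<close>

lemma norm_weighted_sum_le:
  assumes "w \<in> co_S m" "\<And>i. i \<le> m \<Longrightarrow> norm (f i) \<le> C"
  shows "norm (\<Sum>i\<le>m. w i *\<^sub>R (f i :: 'a::real_normed_vector)) \<le> C"
proof -
  have w: "0 \<le> w i" if "i \<le> m" for i
    using assms(1) that by (auto simp: co_S_def PiE_iff)
  have "norm (\<Sum>i\<le>m. w i *\<^sub>R f i) \<le> (\<Sum>i\<le>m. w i * C)"
    using w assms(2) by (intro sum_norm_le) (auto intro!: mult_mono simp: abs_of_nonneg)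
  also have "\<dots> = C"
    using assms(1) by (simp add: co_S_def flip: sum_distrib_right)
  finally show ?thesis .
qed

lemma norm_weighted_diff_le:
  assumes "w \<in> co_S m" "\<And>i. i \<le> m \<Longrightarrow> norm (f i - g i) \<le> C"
  shows "norm ((\<Sum>i\<le>m. w i *\<^sub>R (f i :: 'a::real_normed_vector)) - (\<Sum>i\<le>m. w i *\<^sub>R g i)) \<le> C"
  using norm_weighted_sum_le[of w m "\<lambda>i. f i - g i" C] assms
  by (simp add: scaleR_diff_right sum_subtractf)

lemma controls_co_S: "v \<in> controls m \<Longrightarrow> 0 \<le> s \<Longrightarrow> v s \<in> co_S m"
  by (simp add: controls_def)

text \<open>Controls are merely measurable, so integrability comes from bounded measurability on a
  compact interval.\<close>

lemma control_integrable:
  assumes v: "v \<in> controls m" and "0 \<le> a" and f: "\<And>i. i \<le> m \<Longrightarrow> continuous_on {a..b} (f i)"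
  shows "(\<lambda>s. \<Sum>i\<le>m. v s i *\<^sub>R (f i s :: 'b::euclidean_space)) integrable_on {a..b}"
proof (intro integrable_sum)
  fix i assume i: "i \<in> {..m}"
  obtain C where C: "\<And>s. s \<in> {a..b} \<Longrightarrow> norm (f i s) \<le> C"
    using compact_imp_bounded[OF compact_continuous_image[OF f[of i]]] i
    by (auto simp: bounded_iff simp del: atLeastAtMost_iff)
  show "(\<lambda>s. v s i *\<^sub>R f i s) integrable_on {a..b}"
  proof (rule measurable_bounded_by_integrable_imp_integrable)
    have "(\<lambda>s. v s i) \<in> borel_measurable (lebesgue_on {0..})"
      using v i by (auto simp: controls_def)
    then have "(\<lambda>s. v s i) \<in> borel_measurable (lebesgue_on {a..b})"
      by (rule measurable_restrict_mono) (use \<open>0 \<le> a\<close> in auto)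
    moreover have "f i \<in> borel_measurable (lebesgue_on {a..b})"
      using f i by (intro continuous_imp_measurable_on_sets_lebesgue) auto
    ultimately show "(\<lambda>s. v s i *\<^sub>R f i s) \<in> borel_measurable (lebesgue_on {a..b})"
      by (rule borel_measurable_scaleR)
    show "norm (v s i *\<^sub>R f i s) \<le> C" if s: "s \<in> {a..b}" for s
    proof -
      have "0 \<le> v s i" "v s i \<le> 1"
        using controls_co_S[OF v, of s] s i \<open>0 \<le> a\<close> by (auto simp: co_S_def PiE_iff)
      then show ?thesis
        using C[OF s] mult_left_le_one_le[of "norm (f i s)" "v s i"] by auto
    qed
  qed auto
qed auto

lemma control_component_integrable:
  assumes v: "v \<in> controls m" and "0 \<le> s" "i \<le> m"
  shows "(\<lambda>r. v r i) integrable_on {s..t}"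
  \<comment> \<open>With constant coefficients 1 at \<open>i\<close> and 0 elsewhere the weighted
    sum collapses to one component.\<close>
  using control_integrable[OF v \<open>0 \<le> s\<close>, of t "\<lambda>j _. if j = i then 1 else (0::real)"] \<open>i \<le> m\<close>
  by (simp add: if_distrib cong: if_cong)

text \<open>Extension by 0 gives a Lebesgue measurable function on the whole line, where
  translations preserve measurability. This is what makes concatenated controls measurable.\<close>

lemma shift_measurable_lebesgue_on:
  fixes f :: "real \<Rightarrow> real"
  assumes f: "f \<in> borel_measurable (lebesgue_on {0..})"
  shows "(\<lambda>r. f (r + a)) \<in> borel_measurable (lebesgue_on {- a :: real..})"
proof -
  have "(\<lambda>r. if r \<in> {0..} then f r else 0) \<in> borel_measurable lebesgue"
    by (rule borel_measurable_if_I[OF f]) simp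
  moreover have "(\<lambda>r. r + a) \<in> lebesgue \<rightarrow>\<^sub>M lebesgue"
    using lebesgue_affine_measurable[of "\<lambda>_::real. 1" a] by (simp add: add.commute[of a])
  ultimately have "(\<lambda>r. if r + a \<in> {0..} then f (r + a) else 0) \<in> borel_measurable lebesgue"
    using measurable_compose[of "\<lambda>r. r + a" lebesgue lebesgue "\<lambda>r. if r \<in> {0..} then f r else 0"]
    by (auto simp: add.commute)
  then have "(\<lambda>r. if r + a \<in> {0..} then f (r + a) else 0) \<in> borel_measurable (lebesgue_on {- a..})"
    by (rule measurable_restrict_space1)
  then show ?thesis
    by (rule measurable_cong[THEN iffD1, rotated]) auto
qed

definition concat_control :: "real \<Rightarrow> (real \<Rightarrow> nat \<Rightarrow> real) \<Rightarrow> (real \<Rightarrow> nat \<Rightarrow> real) \<Rightarrow> real \<Rightarrow> nat \<Rightarrow> real" where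
  "concat_control s v w r = (if r < s then v r else w (r - s))"

lemma concat_controls:
  assumes v: "v \<in> controls m" and w: "w \<in> controls m" and "0 \<le> s"
  shows "concat_control s v w \<in> controls m"
proof -
  have "(\<lambda>r. concat_control s v w r i) \<in> borel_measurable (lebesgue_on {0..})" if "i \<le> m" for i
  proof -
    have "(\<lambda>r. w (r + - s) i) \<in> borel_measurable (lebesgue_on {- (- s)..})"
      using w that by (intro shift_measurable_lebesgue_on[of "\<lambda>r. w r i"]) (auto simp: controls_def)
    then have 1: "(\<lambda>r. if r \<in> {s..} then w (r - s) i else 0) \<in> borel_measurable lebesgue"
      by (intro borel_measurable_if_I) auto
    have 2: "(\<lambda>r. v r i) \<in> borel_measurable (lebesgue_on {0..})"
      using v that by (auto simp: controls_def)
    have 3: "(\<lambda>r. if r < s then v r i else if r \<in> {s..} then w (r - s) i else 0)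
        \<in> borel_measurable (lebesgue_on {0..})"
    proof (rule measurable_If)
      have "{..<s} \<inter> {0..} \<in> sets (lebesgue_on {0..})"
        by (subst sets_restrict_space_iff) auto
      then show "{r \<in> space (lebesgue_on {0..}). r < s} \<in> sets (lebesgue_on {0..})"
        by (rule back_subst[of "\<lambda>A. A \<in> _"]) auto
    qed (use 2 measurable_restrict_space1[OF 1] in auto)
    show ?thesis
      by (rule measurable_cong[THEN iffD1, OF _ 3]) (auto simp: concat_control_def)
  qed
  then show ?thesis
    using assms by (auto simp: controls_def concat_control_def)
qed

text \<open>The vertex of the simplex \<open>co_S m\<close> that selects field \<open>i\<close>. The
  restriction to \<open>{..m}\<close> is forced by the extensional function space in
  \<open>co_S\<close>.\<close>

definition const_control :: "nat \<Rightarrow> nat \<Rightarrow> real \<Rightarrow> nat \<Rightarrow> real" where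
  "const_control m i = (\<lambda>_. \<lambda>j\<in>{..m}. if j = i then 1 else 0)"

lemma const_controls: "i \<le> m \<Longrightarrow> const_control m i \<in> controls m"
  by (auto simp: const_control_def controls_def co_S_def)

lemma sum_const_control: "i \<le> m \<Longrightarrow> (\<Sum>j\<le>m. const_control m i s j *\<^sub>R f j) = (f i :: 'a::real_vector)"
  by (simp add: const_control_def if_distrib[of "\<lambda>r. r *\<^sub>R _"] cong: if_cong)

lemma controls_nonempty: "\<exists>v. v \<in> controls m"
  using const_controls[of 0] by blast

section \<open>Trajectories of the control system\<close>

text \<open>Isolates what the trajectory theory takes from smoothness and boundedness: one speed
  bound for all fields and, on every ball, one Lipschitz constant for all fields.\<close>

locale bounded_fields =
  fixes m :: nat and F :: "nat \<Rightarrow> 'a \<Rightarrow> 'a::euclidean_space" and B :: real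
  assumes norm_F: "i \<le> m \<Longrightarrow> norm (F i y) \<le> B"
    and F_lipschitz: "\<exists>L>0. \<forall>i\<le>m. \<forall>y\<in>cball 0 r. \<forall>z\<in>cball 0 r. norm (F i y - F i z) \<le> L * norm (y - z)"
begin

text \<open>A finite horizon confines the trajectory to a known ball, where a Lipschitz constant is
  available.\<close>

definition solves_on :: "'a \<Rightarrow> (real \<Rightarrow> nat \<Rightarrow> real) \<Rightarrow> real \<Rightarrow> (real \<Rightarrow> 'a) \<Rightarrow> bool" where
  "solves_on x v T \<xi> \<longleftrightarrow> continuous_on {0..T} \<xi> \<and>
     (\<forall>t\<in>{0..T}. ((\<lambda>s. \<Sum>i\<le>m. v s i *\<^sub>R F i (\<xi> s)) has_integral (\<xi> t - x)) {0..t})"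

lemma B_nonneg: "0 \<le> B"
  using norm_F[of 0 0] norm_ge_zero order_trans by blast

lemma continuous_F:
  assumes "i \<le> m"
  shows "continuous_on UNIV (F i)"
proof -
  have "isCont (F i) x" for x
  proof -
    obtain L where "0 < L" and L: "\<And>y z. y \<in> cball 0 (norm x + 1) \<Longrightarrow> z \<in> cball 0 (norm x + 1) \<Longrightarrow>
        norm (F i y - F i z) \<le> L * norm (y - z)"
      using F_lipschitz[of "norm x + 1"] assms by blast
    have "L-lipschitz_on (cball 0 (norm x + 1)) (F i)"
      using L \<open>0 < L\<close> by (intro lipschitz_onI) (auto simp: dist_norm)
    then have "continuous_on (cball 0 (norm x + 1)) (F i)"
      by (rule lipschitz_on_continuous_on)
    then show ?thesis
      by (rule continuous_on_interior) auto
  qed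
  then show ?thesis by (simp add: continuous_at_imp_continuous_on)
qed

section \<open>Finite-horizon trajectories: a priori bounds, dependence on the initial point,
  existence\<close>

lemma solves_on_increment:
  assumes "solves_on x v T \<xi>" "0 \<le> s" "s \<le> t" "t \<le> T"
  shows "((\<lambda>r. \<Sum>i\<le>m. v r i *\<^sub>R F i (\<xi> r)) has_integral (\<xi> t - \<xi> s)) {s..t}"
proof -
  let ?g = "\<lambda>r. \<Sum>i\<le>m. v r i *\<^sub>R F i (\<xi> r)"
  have t: "(?g has_integral (\<xi> t - x)) {0..t}" and s: "(?g has_integral (\<xi> s - x)) {0..s}"
    using assms by (auto simp: solves_on_def)
  have "?g integrable_on {s..t}"
    using t assms by (meson atLeastatMost_subset_iff has_integral_integrable integrable_on_subinterval order_refl)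
  moreover
  have "integral {0..s} ?g + integral {s..t} ?g = integral {0..t} ?g"
    using t assms by (intro Henstock_Kurzweil_Integration.integral_combine) auto
  then have "(\<xi> s - x) + integral {s..t} ?g = \<xi> t - x"
    unfolding integral_unique[OF s] integral_unique[OF t] .
  then have "integral {s..t} ?g = \<xi> t - \<xi> s"
    by (simp add: algebra_simps)
  ultimately show ?thesis
    by (auto simp: has_integral_iff)
qed

lemma solves_on_lipschitz:
  assumes "solves_on x v T \<xi>" "v \<in> controls m" "0 \<le> s" "s \<le> t" "t \<le> T"
  shows "norm (\<xi> t - \<xi> s) \<le> B * (t - s)"
proof -
  have "norm (\<Sum>i\<le>m. v r i *\<^sub>R F i (\<xi> r)) \<le> B" if "r \<in> {s..t}" for r
    using that assms by (intro norm_weighted_sum_le norm_F controls_co_S) auto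
  then show ?thesis
    using has_integral_bound[OF B_nonneg, of _ "\<xi> t - \<xi> s" s t] solves_on_increment[OF assms(1,3,4,5)] assms(4)
    by auto
qed

lemma solves_on_0:
  assumes "solves_on x v T \<xi>" "0 \<le> T"
  shows "\<xi> 0 = x"
proof -
  have "((\<lambda>s. \<Sum>i\<le>m. v s i *\<^sub>R F i (\<xi> s)) has_integral (\<xi> 0 - x)) {0}"
    using assms by (auto simp: solves_on_def dest!: bspec[where x = 0])
  from has_integral_unique[OF this has_integral_refl(2)] show ?thesis
    by simp
qed

lemma solves_on_norm_le:
  assumes "solves_on x v T \<xi>" "v \<in> controls m" "t \<in> {0..T}"
  shows "norm (\<xi> t - x) \<le> B * t"
  using solves_on_lipschitz[OF assms(1,2), of 0 t] solves_on_0[OF assms(1)] assms(3) by auto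

text \<open>Up to time \<open>T\<close> both trajectories stay in the ball of radius
  \<open>R + B * T\<close>, so the local constant \<open>L\<close> applies and the Gronwall
  inequality bounds the norm of the difference.\<close>

lemma solves_on_dist_le:
  assumes L: "0 < L" "\<And>i y z. i \<le> m \<Longrightarrow> y \<in> cball 0 (R + B * T) \<Longrightarrow> z \<in> cball 0 (R + B * T) \<Longrightarrow>
      norm (F i y - F i z) \<le> L * norm (y - z)"
    and v: "v \<in> controls m"
    and x: "norm x \<le> R" "solves_on x v T \<xi>" and y: "norm y \<le> R" "solves_on y v T \<eta>"
    and t: "t \<in> {0..T}"
  shows "norm (\<xi> t - \<eta> t) \<le> 2 * norm (x - y) * exp (2 * L * t)"
proof (rule gronwall_integral_inequality[of T, OF _ _ \<open>0 < L\<close> _ t])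
  show "continuous_on {0..T} (\<lambda>t. norm (\<xi> t - \<eta> t))"
    using x y by (auto intro!: continuous_intros simp: solves_on_def)
  fix t assume t: "t \<in> {0..T}"
  have ball: "\<zeta> s \<in> cball 0 (R + B * T)" if "solves_on z v T \<zeta>" "norm z \<le> R" "s \<in> {0..T}" for \<zeta> z s
  proof -
    have "norm (\<zeta> s) \<le> norm (\<zeta> s - z) + norm z"
      by (metis diff_add_cancel norm_triangle_ineq)
    moreover have "B * s \<le> B * T"
      using that B_nonneg by (auto intro: mult_left_mono)
    ultimately show ?thesis
      using solves_on_norm_le[OF that(1) v that(3)] that(2) by auto
  qed
  let ?g = "\<lambda>\<xi> s. \<Sum>i\<le>m. v s i *\<^sub>R F i (\<xi> s)"
  have ix: "(?g \<xi> has_integral (\<xi> t - x)) {0..t}" and iy: "(?g \<eta> has_integral (\<eta> t - y)) {0..t}"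
    using x y t by (auto simp: solves_on_def)
  have "norm (integral {0..t} (\<lambda>s. ?g \<xi> s - ?g \<eta> s)) \<le> integral {0..t} (\<lambda>s. L * norm (\<xi> s - \<eta> s))"
  proof (rule Henstock_Kurzweil_Integration.integral_norm_bound_integral)
    show "(\<lambda>s. ?g \<xi> s - ?g \<eta> s) integrable_on {0..t}"
      using ix iy by (auto intro: integrable_diff)
    show "(\<lambda>s. L * norm (\<xi> s - \<eta> s)) integrable_on {0..t}"
      using x y t by (auto intro!: integrable_continuous_interval continuous_intros
          intro: continuous_on_subset simp: solves_on_def)
    show "norm (?g \<xi> s - ?g \<eta> s) \<le> L * norm (\<xi> s - \<eta> s)" if "s \<in> {0..t}" for s
      using that t by (intro norm_weighted_diff_le controls_co_S v L ball[OF x(2,1)] ball[OF y(2,1)]) auto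
  qed
  moreover have "integral {0..t} (\<lambda>s. ?g \<xi> s - ?g \<eta> s) = (\<xi> t - \<eta> t) - (x - y)"
    using has_integral_diff[OF ix iy] by (simp add: integral_unique algebra_simps)
  ultimately have "norm ((\<xi> t - \<eta> t) - (x - y)) \<le> L * integral {0..t} (\<lambda>s. norm (\<xi> s - \<eta> s))"
    by simp
  then show "norm (\<xi> t - \<eta> t) \<le> norm (x - y) + L * integral {0..t} (\<lambda>s. norm (\<xi> s - \<eta> s))"
    using norm_triangle_ineq2[of "\<xi> t - \<eta> t" "x - y"] by linarith
qed auto

lemma solves_on_unique:
  assumes v: "v \<in> controls m" and "solves_on x v T \<xi>" "solves_on x v T' \<eta>" "0 \<le> t" "t \<le> T" "t \<le> T'"
  shows "\<xi> t = \<eta> t"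
proof -
  obtain L where "0 < L" and L: "\<And>i y z. i \<le> m \<Longrightarrow> y \<in> cball 0 (norm x + B * t) \<Longrightarrow>
      z \<in> cball 0 (norm x + B * t) \<Longrightarrow> norm (F i y - F i z) \<le> L * norm (y - z)"
    using F_lipschitz[of "norm x + B * t"] by blast
  have "solves_on x v t \<xi>" "solves_on x v t \<eta>"
    using assms by (auto simp: solves_on_def intro: continuous_on_subset)
  from solves_on_dist_le[OF \<open>0 < L\<close> L v order_refl this(1) order_refl this(2), of t]
  show ?thesis
    using assms by auto
qed

text \<open>Composing the fields with the nearest-point projection onto the ball of radius
  \<open>B * T\<close> around \<open>x\<close> makes them globally Lipschitz without raising the
  speed bound. The resulting solution cannot leave that ball before time \<open>T\<close>, so it
  never notices the projection.\<close>

lemma exists_solves_on: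
  assumes v: "v \<in> controls m" and "0 \<le> T"
  shows "\<exists>\<xi>. solves_on x v T \<xi>"
proof -
  define A where "A = cball x (B * T)"
  have A: "convex A" "closed A" "A \<noteq> {}"
    using mult_nonneg_nonneg[OF B_nonneg \<open>0 \<le> T\<close>] by (auto simp: A_def)
  have sub: "A \<subseteq> cball 0 (norm x + B * T)"
    unfolding A_def by (simp add: cball_subset_cball_iff)
  obtain L where "0 < L" and L: "\<And>i y z. i \<le> m \<Longrightarrow> y \<in> cball 0 (norm x + B * T) \<Longrightarrow>
      z \<in> cball 0 (norm x + B * T) \<Longrightarrow> norm (F i y - F i z) \<le> L * norm (y - z)"
    using F_lipschitz[of "norm x + B * T"] by blast
  define g where "g s y = (\<Sum>i\<le>m. v s i *\<^sub>R F i (closest_point A y))" for s y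
  have norm_g: "norm (g s y) \<le> B" if "0 \<le> s" for s y
    unfolding g_def using that v by (intro norm_weighted_sum_le norm_F controls_co_S) auto
  have "\<exists>\<xi>. continuous_on {0..} \<xi> \<and>
           (\<forall>t\<ge>0. ((\<lambda>s. g s (\<xi> s)) has_integral (\<xi> t - x)) {0..t})"
  proof (rule global_caratheodory_solution[OF \<open>0 < L\<close> norm_g])
    show "norm (g s y - g s z) \<le> L * norm (y - z)" if "0 \<le> s" for s y z
    proof -
      have "norm (F i (closest_point A y) - F i (closest_point A z)) \<le> L * norm (y - z)" if "i \<le> m" for i
      proof -
        have "norm (F i (closest_point A y) - F i (closest_point A z))
            \<le> L * norm (closest_point A y - closest_point A z)"
          by (intro L that subsetD[OF sub] closest_point_in_set A)
        also have "\<dots> \<le> L * norm (y - z)"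
          using closest_point_lipschitz[OF A, of y z] \<open>0 < L\<close> by (auto simp: dist_norm)
        finally show ?thesis .
      qed
      then show ?thesis
        unfolding g_def using that v by (intro norm_weighted_diff_le controls_co_S) auto
    qed
    show "(\<lambda>s. g s (\<xi> s)) integrable_on {0..t}" if "continuous_on {0..} \<xi>" for \<xi> and t :: real
      unfolding g_def
      by (intro control_integrable[OF v] continuous_on_compose2[OF continuous_F]
          continuous_on_compose2[OF continuous_on_closest_point[OF A, of UNIV]]
          continuous_on_subset[OF that]) auto
  qed
  then obtain \<xi> where cont: "continuous_on {0..} \<xi>"
    and int: "\<And>t. 0 \<le> t \<Longrightarrow> ((\<lambda>s. g s (\<xi> s)) has_integral (\<xi> t - x)) {0..t}"
    by blast
  have "\<xi> s \<in> A" if "s \<in> {0..T}" for s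
  proof -
    have "norm (\<xi> s - x) \<le> B * s"
      using has_integral_bound[OF B_nonneg, of _ "\<xi> s - x" 0 s] int[of s] norm_g that by auto
    also have "\<dots> \<le> B * T"
      using that B_nonneg by (auto intro: mult_left_mono)
    finally show ?thesis
      by (simp add: A_def dist_norm norm_minus_commute)
  qed
  then have "g s (\<xi> s) = (\<Sum>i\<le>m. v s i *\<^sub>R F i (\<xi> s))" if "s \<in> {0..T}" for s
    using that by (simp add: g_def closest_point_self)
  then have "((\<lambda>s. \<Sum>i\<le>m. v s i *\<^sub>R F i (\<xi> s)) has_integral (\<xi> t - x)) {0..t}" if "t \<in> {0..T}" for t
    using that by (intro has_integral_eq[OF _ int]) auto
  then have "solves_on x v T \<xi>"
    using cont by (auto simp: solves_on_def intro: continuous_on_subset)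
  then show ?thesis by blast
qed

lemma exists_solves_control_system:
  assumes v: "v \<in> controls m"
  shows "\<exists>\<xi>. solves_control_system m F x v \<xi>"
proof -
  define X where "X n = (SOME \<xi>. solves_on x v (real n) \<xi>)" for n
  have X: "solves_on x v (real n) (X n)" for n
    unfolding X_def by (rule someI_ex[of "solves_on x v (real n)"]) (simp add: exists_solves_on[OF v])
  \<comment> \<open>The solutions with integer horizons are glued; uniqueness makes any horizon
    beyond \<open>t\<close> give the same value. The common Lipschitz constant \<open>B\<close> then
    yields continuity.\<close>
  define \<xi> where "\<xi> t = X (nat \<lceil>t\<rceil>) t" for t
  have eq: "\<xi> t = X n t" if "0 \<le> t" "t \<le> n" for t n
    unfolding \<xi>_def using that by (intro solves_on_unique[OF v X X]) (auto simp: real_nat_ceiling_ge)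
  have "B-lipschitz_on {0..} \<xi>"
  proof (rule lipschitz_on_leI)
    fix s t :: real assume "s \<in> {0..}" "t \<in> {0..}" "s \<le> t"
    define n where "n = nat \<lceil>t\<rceil>"
    have "0 \<le> s" "s \<le> t" "t \<le> real n"
      using \<open>s \<in> {0..}\<close> \<open>s \<le> t\<close> by (auto simp: n_def real_nat_ceiling_ge)
    then have "norm (\<xi> t - \<xi> s) \<le> B * (t - s)"
      using solves_on_lipschitz[OF X v, of s t n] eq[of t n] eq[of s n] by simp
    then show "dist (\<xi> s) (\<xi> t) \<le> B * dist s t"
      using \<open>s \<le> t\<close> by (simp add: dist_norm norm_minus_commute)
  qed (rule B_nonneg)
  then have "continuous_on {0..} \<xi>"
    by (rule lipschitz_on_continuous_on)
  moreover have "((\<lambda>s. \<Sum>i\<le>m. v s i *\<^sub>R F i (\<xi> s)) has_integral (\<xi> t - x)) {0..t}" if "0 \<le> t" for t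
  proof -
    define n where "n = nat \<lceil>t\<rceil>"
    have n: "t \<le> n" by (simp add: n_def real_nat_ceiling_ge)
    have "((\<lambda>s. \<Sum>i\<le>m. v s i *\<^sub>R F i (X n s)) has_integral (\<xi> t - x)) {0..t}"
      using X[of n] that n eq[OF that n] by (auto simp: solves_on_def)
    then show ?thesis
    proof (rule has_integral_eq[rotated])
      fix s assume "s \<in> {0..t}"
      then have "\<xi> s = X n s"
        using n by (intro eq) auto
      then show "(\<Sum>i\<le>m. v s i *\<^sub>R F i (X n s)) = (\<Sum>i\<le>m. v s i *\<^sub>R F i (\<xi> s))"
        by simp
    qed
  qed
  ultimately show ?thesis
    by (auto simp: solves_control_system_def)
qed

section \<open>The trajectory map: identification, regularity, composition\<close>

lemma phi_solves_on:
  assumes "v \<in> controls m"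
  shows "solves_on x v T (\<lambda>t. phi m F t x v)"
  using someI_ex[OF exists_solves_control_system[OF assms, of x]]
  by (auto simp: solves_on_def solves_control_system_def phi_def intro: continuous_on_subset)

text \<open>Together with \<open>phi_solves_on\<close> this replaces the definition of
  \<open>phi\<close> by choice, which is not unfolded any more.\<close>

lemma phi_eqI:
  assumes "v \<in> controls m" "solves_on x v t \<xi>" "0 \<le> t"
  shows "phi m F t x v = \<xi> t"
  using solves_on_unique[OF assms(1) phi_solves_on[OF assms(1)] assms(2)] assms(3) by blast

lemma phi_0 [simp]: "v \<in> controls m \<Longrightarrow> phi m F 0 x v = x"
  using solves_on_0[OF phi_solves_on] by blast

lemma norm_phi_le:
  assumes "v \<in> controls m" "0 \<le> t"
  shows "norm (phi m F t x v - x) \<le> B * t"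
  using solves_on_norm_le[OF phi_solves_on[OF assms(1)] assms(1), of t t] assms(2) by auto

lemma phi_time_lipschitz:
  assumes "v \<in> controls m" "0 \<le> s" "0 \<le> t"
  shows "norm (phi m F t x v - phi m F s x v) \<le> B * \<bar>t - s\<bar>"
proof (rule linorder_le_cases[of s t])
  assume "s \<le> t"
  then show ?thesis
    using solves_on_lipschitz[OF phi_solves_on[OF assms(1)] assms(1,2), of t t] by auto
next
  assume "t \<le> s"
  then show ?thesis
    using solves_on_lipschitz[OF phi_solves_on[OF assms(1)] assms(1,3), of s s]
    by (auto simp: norm_minus_commute)
qed

lemma phi_space_lipschitz:
  "\<exists>C>0. \<forall>x\<in>cball 0 R. \<forall>y\<in>cball 0 R. \<forall>v\<in>controls m. \<forall>t\<in>{0..T}.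
     norm (phi m F t x v - phi m F t y v) \<le> C * norm (x - y)"
proof -
  obtain L where "0 < L" and L: "\<And>i y z. i \<le> m \<Longrightarrow> y \<in> cball 0 (R + B * T) \<Longrightarrow>
      z \<in> cball 0 (R + B * T) \<Longrightarrow> norm (F i y - F i z) \<le> L * norm (y - z)"
    using F_lipschitz[of "R + B * T"] by blast
  have "norm (phi m F t x v - phi m F t y v) \<le> 2 * exp (2 * L * T) * norm (x - y)"
    if "x \<in> cball 0 R" "y \<in> cball 0 R" "v \<in> controls m" "t \<in> {0..T}" for x y v t
  proof -
    have "norm (phi m F t x v - phi m F t y v) \<le> 2 * norm (x - y) * exp (2 * L * t)"
      using that by (intro solves_on_dist_le[OF \<open>0 < L\<close> L that(3) _ phi_solves_on _ phi_solves_on]) auto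
    also have "\<dots> \<le> 2 * norm (x - y) * exp (2 * L * T)"
      using that \<open>0 < L\<close> by (intro mult_left_mono) auto
    finally show ?thesis by (simp add: mult_ac)
  qed
  then show ?thesis
    by (intro exI[of _ "2 * exp (2 * L * T)"]) auto
qed

lemma continuous_phi:
  assumes "v \<in> controls m" "0 \<le> t"
  shows "continuous_on UNIV (\<lambda>x. phi m F t x v)"
proof -
  have "isCont (\<lambda>x. phi m F t x v) x" for x
  proof -
    obtain C where "0 < C" and C: "\<And>y z. y \<in> cball 0 (norm x + 1) \<Longrightarrow> z \<in> cball 0 (norm x + 1) \<Longrightarrow>
        norm (phi m F t y v - phi m F t z v) \<le> C * norm (y - z)"
      using phi_space_lipschitz[of "norm x + 1" t] assms by auto
    have "C-lipschitz_on (cball 0 (norm x + 1)) (\<lambda>x. phi m F t x v)"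
      using C \<open>0 < C\<close> by (intro lipschitz_onI) (auto simp: dist_norm)
    then have "continuous_on (cball 0 (norm x + 1)) (\<lambda>x. phi m F t x v)"
      by (rule lipschitz_on_continuous_on)
    then show ?thesis
      by (rule continuous_on_interior) auto
  qed
  then show ?thesis by (simp add: continuous_at_imp_continuous_on)
qed

lemma phi_cong:
  assumes v: "v \<in> controls m" and w: "w \<in> controls m" and "0 \<le> t"
    and eq: "\<And>s. 0 \<le> s \<Longrightarrow> s < t \<Longrightarrow> v s = w s"
  shows "phi m F t x v = phi m F t x w"
proof (rule phi_eqI[OF v _ \<open>0 \<le> t\<close>])
  have "((\<lambda>s. \<Sum>i\<le>m. v s i *\<^sub>R F i (phi m F s x w)) has_integral (phi m F r x w - x)) {0..r}"
    if "r \<in> {0..t}" for r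
  \<comment> \<open>The controls need not agree at time \<open>t\<close> itself, which is negligible
    for the integral. Concatenated controls switch exactly there.\<close>
  proof (rule has_integral_spike_finite[of "{t}"])
    show "((\<lambda>s. \<Sum>i\<le>m. w s i *\<^sub>R F i (phi m F s x w)) has_integral (phi m F r x w - x)) {0..r}"
      using phi_solves_on[OF w, of x t] that by (auto simp: solves_on_def)
  qed (use that eq in auto)
  then show "solves_on x v t (\<lambda>t. phi m F t x w)"
    using phi_solves_on[OF w, of x t] by (auto simp: solves_on_def)
qed

text \<open>The trajectory observed from time \<open>s\<close> on solves the equation for the
  control with restarted clock, so uniqueness gives the cocycle property.\<close>

lemma phi_shift:
  assumes v: "v \<in> controls m" and w: "w \<in> controls m" and "0 \<le> s" "0 \<le> t"
    and eq: "\<And>r. 0 \<le> r \<Longrightarrow> v (s + r) = w r"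
  shows "phi m F (s + t) x v = phi m F t (phi m F s x v) w"
proof (rule phi_eqI[OF w _ \<open>0 \<le> t\<close>, symmetric])
  let ?\<xi> = "\<lambda>r. phi m F r x v"
  have "((\<lambda>r. \<Sum>i\<le>m. w r i *\<^sub>R F i (?\<xi> (s + r))) has_integral (?\<xi> (s + r) - ?\<xi> s)) {0..r}"
    if "r \<in> {0..t}" for r
  proof -
    have *: "((\<lambda>r. \<Sum>i\<le>m. v r i *\<^sub>R F i (?\<xi> r)) has_integral (?\<xi> (s + r) - ?\<xi> s)) {s..s + r}"
      using that \<open>0 \<le> s\<close> by (intro solves_on_increment[OF phi_solves_on[OF v, of x "s + t"]]) auto
    have "((\<lambda>r. \<Sum>i\<le>m. v (r + s) i *\<^sub>R F i (?\<xi> (r + s))) has_integral (?\<xi> (s + r) - ?\<xi> s)) {0..r}"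
      using has_integral_shift_real_ivl[OF *, of s] by simp
    then show ?thesis
      by (rule has_integral_eq[rotated]) (use eq in \<open>auto simp: add.commute\<close>)
  qed
  moreover have "continuous_on {0..t} (\<lambda>r. ?\<xi> (s + r))"
  proof (rule continuous_on_compose2[of "{0..s + t}" ?\<xi> _ "\<lambda>r. s + r"])
    show "continuous_on {0..s + t} ?\<xi>"
      using phi_solves_on[OF v, of x "s + t"] by (simp add: solves_on_def)
  qed (use \<open>0 \<le> s\<close> in \<open>auto intro!: continuous_intros\<close>)
  ultimately show "solves_on (?\<xi> s) w t (\<lambda>r. ?\<xi> (s + r))"
    by (auto simp: solves_on_def)
qed

lemma phi_concat:
  assumes v: "v \<in> controls m" and w: "w \<in> controls m" and "0 \<le> s" "0 \<le> t"
  shows "phi m F (s + t) x (concat_control s v w) = phi m F t (phi m F s x v) w"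
proof -
  have "phi m F (s + t) x (concat_control s v w) = phi m F t (phi m F s x (concat_control s v w)) w"
    using assms by (intro phi_shift concat_controls) (auto simp: concat_control_def)
  also have "phi m F s x (concat_control s v w) = phi m F s x v"
    using assms by (intro phi_cong concat_controls) (auto simp: concat_control_def)
  finally show ?thesis .
qed

text \<open>The trajectory of the vertex control is differentiable, since its integrand is
  continuous, and so witnesses that the choice in \<open>flow\<close> has a candidate. Whatever that
  choice picks solves the integral equation, and uniqueness identifies the two.\<close>

lemma flow_eq_phi:
  assumes i: "i \<le> m" and "0 \<le> t"
  shows "flow (F i) t x = phi m F t x (const_control m i)"
proof -
  let ?P = "\<lambda>\<xi>. \<xi> 0 = x \<and> (\<forall>s\<ge>0. (\<xi> has_vector_derivative F i (\<xi> s)) (at s within {0..}))"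
  let ?\<xi> = "\<lambda>t. phi m F t x (const_control m i)"
  have integral: "((\<lambda>s. F i (?\<xi> s)) has_integral (?\<xi> t - x)) {0..t}" if "0 \<le> t" for t
    using phi_solves_on[OF const_controls[OF i], of x t] i that
    by (auto simp: solves_on_def sum_const_control)
  have cont: "continuous_on {0..T} ?\<xi>" for T
    using phi_solves_on[OF const_controls[OF i], of x T] by (simp add: solves_on_def)
  have "?P ?\<xi>"
  proof (intro conjI allI impI)
    show "?\<xi> 0 = x" using const_controls[OF i] by simp
    fix s :: real assume "0 \<le> s"
    have "((\<lambda>u. integral {0..u} (\<lambda>s. F i (?\<xi> s))) has_vector_derivative F i (?\<xi> s)) (at s within {0..s + 1})"
      using \<open>0 \<le> s\<close> by (intro integral_has_vector_derivative continuous_on_compose2[OF continuous_F[OF i] cont]) auto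
    then have "((\<lambda>u. x + integral {0..u} (\<lambda>s. F i (?\<xi> s))) has_vector_derivative F i (?\<xi> s)) (at s within {0..s + 1})"
      by (auto intro!: derivative_eq_intros)
    then have "(?\<xi> has_vector_derivative F i (?\<xi> s)) (at s within {0..s + 1})"
      by (rule has_vector_derivative_transform[rotated 2])
         (use \<open>0 \<le> s\<close> integral in \<open>auto simp: has_integral_iff\<close>)
    moreover have "at s within {0..s + 1} = at s within {0..}"
      by (rule at_within_nhd[of s "{..<s + 1}"]) auto
    ultimately show "(?\<xi> has_vector_derivative F i (?\<xi> s)) (at s within {0..})"
      by simp
  qed
  then have P: "?P (SOME \<xi>. ?P \<xi>)"
    by (rule someI[of ?P])
  let ?\<zeta> = "\<lambda>t. flow (F i) t x"
  have "solves_on x (const_control m i) t ?\<zeta>"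
    unfolding solves_on_def
  proof (intro conjI ballI)
    have deriv: "(?\<zeta> has_vector_derivative F i (?\<zeta> s)) (at s within S)" if "0 \<le> s" "S \<subseteq> {0..}" for s S
      using P that by (auto simp: flow_def[abs_def] intro: has_vector_derivative_within_subset)
    show "continuous_on {0..t} ?\<zeta>"
      by (rule continuous_on_vector_derivative[of _ _ "\<lambda>s. F i (?\<zeta> s)"]) (auto intro: deriv)
    fix r assume "r \<in> {0..t}"
    then have "((\<lambda>s. F i (?\<zeta> s)) has_integral (?\<zeta> r - ?\<zeta> 0)) {0..r}"
      by (intro fundamental_theorem_of_calculus deriv) auto
    moreover have "?\<zeta> 0 = x" using P by (simp add: flow_def)
    ultimately show "((\<lambda>s. \<Sum>j\<le>m. const_control m i s j *\<^sub>R F j (?\<zeta> s)) has_integral (?\<zeta> r - x)) {0..r}"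
      using i by (simp add: sum_const_control)
  qed
  then show ?thesis
    using phi_eqI[OF const_controls[OF i] _ \<open>0 \<le> t\<close>] by simp
qed

section \<open>Relaxation\<close>

text \<open>With the fields frozen at \<open>y\<close>, only the integrals of the control components
  matter. The Lipschitz constant bounds the error of freezing by the distance to \<open>y\<close>
  plus the distance travelled.\<close>

lemma phi_increment_approx:
  assumes v: "v \<in> controls m" and st: "0 \<le> s" "s \<le> t"
    and L: "0 < L" "\<And>i y z. i \<le> m \<Longrightarrow> y \<in> cball 0 R \<Longrightarrow> z \<in> cball 0 R \<Longrightarrow>
      norm (F i y - F i z) \<le> L * norm (y - z)"
    and y: "y \<in> cball 0 R" and ball: "\<And>r. r \<in> {s..t} \<Longrightarrow> phi m F r x v \<in> cball 0 R"
  shows "norm (phi m F t x v - phi m F s x v - (\<Sum>i\<le>m. integral {s..t} (\<lambda>r. v r i) *\<^sub>R F i y))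
    \<le> L * (norm (phi m F s x v - y) + B * (t - s)) * (t - s)"
proof -
  let ?\<xi> = "\<lambda>r. phi m F r x v"
  let ?K = "L * (norm (?\<xi> s - y) + B * (t - s))"
  have "((\<lambda>r. \<Sum>i\<le>m. v r i *\<^sub>R F i y) has_integral (\<Sum>i\<le>m. integral {s..t} (\<lambda>r. v r i) *\<^sub>R F i y)) {s..t}"
    using v st by (intro has_integral_sum has_integral_scaleR_left integrable_integral
        control_component_integrable) auto
  then have int: "((\<lambda>r. (\<Sum>i\<le>m. v r i *\<^sub>R F i (?\<xi> r)) - (\<Sum>i\<le>m. v r i *\<^sub>R F i y)) has_integral
      (?\<xi> t - ?\<xi> s - (\<Sum>i\<le>m. integral {s..t} (\<lambda>r. v r i) *\<^sub>R F i y))) {s..t}"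
    using st by (intro has_integral_diff solves_on_increment[OF phi_solves_on[OF v]]) auto
  have le: "norm ((\<Sum>i\<le>m. v r i *\<^sub>R F i (?\<xi> r)) - (\<Sum>i\<le>m. v r i *\<^sub>R F i y)) \<le> ?K" if r: "r \<in> {s..t}" for r
  proof (rule norm_weighted_diff_le)
    fix i assume "i \<le> m"
    have "norm (F i (?\<xi> r) - F i y) \<le> L * norm (?\<xi> r - y)"
      by (intro L ball y r \<open>i \<le> m\<close>)
    also have "norm (?\<xi> r - y) \<le> norm (?\<xi> r - ?\<xi> s) + norm (?\<xi> s - y)"
      using norm_triangle_ineq[of "?\<xi> r - ?\<xi> s" "?\<xi> s - y"] by simp
    also have "norm (?\<xi> r - ?\<xi> s) \<le> B * \<bar>r - s\<bar>"
      using r st by (intro phi_time_lipschitz v) auto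
    also have "\<dots> \<le> B * (t - s)"
      using r B_nonneg by (intro mult_left_mono) auto
    finally show "norm (F i (?\<xi> r) - F i y) \<le> ?K"
      using L(1) by (simp add: add.commute)
  qed (use r st v controls_co_S in auto)
  have "0 \<le> ?K"
    using L(1) B_nonneg st by auto
  from has_integral_bound[OF this int[folded box_real(2)]] le st show ?thesis
    by auto
qed

lemma flow_increment_approx:
  assumes "i \<le> m" "0 \<le> t"
    and L: "0 < L" "\<And>i y z. i \<le> m \<Longrightarrow> y \<in> cball 0 R \<Longrightarrow> z \<in> cball 0 R \<Longrightarrow>
      norm (F i y - F i z) \<le> L * norm (y - z)"
    and y: "y \<in> cball 0 R" and z: "norm z + B * t \<le> R"
  shows "norm (flow (F i) t z - z - t *\<^sub>R F i y) \<le> L * (norm (z - y) + B * t) * t"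
proof -
  have v: "const_control m i \<in> controls m"
    using assms(1) by (rule const_controls)
  have ball: "phi m F r z (const_control m i) \<in> cball 0 R" if "r \<in> {0..t}" for r
  proof -
    have "norm (phi m F r z (const_control m i)) \<le> norm (phi m F r z (const_control m i) - z) + norm z"
      by (metis diff_add_cancel norm_triangle_ineq)
    moreover have "B * r \<le> B * t"
      using that B_nonneg by (auto intro: mult_left_mono)
    ultimately show ?thesis
      using norm_phi_le[OF v, of r z] that z by auto
  qed
  \<comment> \<open>For a vertex control the integrated weights are \<open>t\<close> at
    \<open>i\<close> and 0 elsewhere.\<close>
  have "(\<Sum>j\<le>m. integral {0..t} (\<lambda>r. const_control m i r j) *\<^sub>R F j y) = t *\<^sub>R F i y"
  proof -
    have "(\<Sum>j\<le>m. integral {0..t} (\<lambda>r. const_control m i r j) *\<^sub>R F j y) = (\<Sum>j\<le>m. if j = i then t *\<^sub>R F i y else 0)"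
      using \<open>0 \<le> t\<close> by (intro sum.cong) (auto simp: const_control_def)
    then show ?thesis using \<open>i \<le> m\<close> by simp
  qed
  then show ?thesis
    using phi_increment_approx[OF v order_refl \<open>0 \<le> t\<close> L y, of z] ball
    by (simp add: flow_eq_phi assms(1,2) v)
qed

text \<open>Running the fields one after the other for times \<open>w i\<close> approximates an Euler step of the
  field \<open>\<Sum>i. w i *\<^sub>R F i\<close> up to an error of second order.\<close>

lemma flow_composition_approx:
  assumes inv: "\<And>i t y. i \<le> m \<Longrightarrow> 0 \<le> t \<Longrightarrow> y \<in> S \<Longrightarrow> flow (F i) t y \<in> S"
    and L: "0 < L" "\<And>i y z. i \<le> m \<Longrightarrow> y \<in> cball 0 R \<Longrightarrow> z \<in> cball 0 R \<Longrightarrow>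
      norm (F i y - F i z) \<le> L * norm (y - z)"
    and w: "\<And>i. i \<le> m \<Longrightarrow> 0 \<le> w i" "(\<Sum>i\<le>m. w i) = h"
    and z: "z \<in> S" "norm z + B * h \<le> R"
  shows "\<exists>z'\<in>S. norm (z' - (z + (\<Sum>i\<le>m. w i *\<^sub>R F i z))) \<le> L * B * h * h"
proof -
  \<comment> \<open>The induction over the fields also records how far the point has drifted from
    \<open>z\<close>, because every field is frozen at \<open>z\<close> although it is run from
    \<open>z'\<close>.\<close>
  have "\<exists>z'\<in>S. norm (z' - z) \<le> B * (\<Sum>i<k. w i) \<and>
      norm (z' - (z + (\<Sum>i<k. w i *\<^sub>R F i z))) \<le> L * B * h * (\<Sum>i<k. w i)" if "k \<le> Suc m" for k
    using that
  proof (induction k)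
    case 0
    show ?case using z(1) by (intro bexI[of _ z]) auto
  next
    case (Suc k)
    then have k: "k \<le> m" by simp
    obtain z' where z': "z' \<in> S" "norm (z' - z) \<le> B * (\<Sum>i<k. w i)"
      "norm (z' - (z + (\<Sum>i<k. w i *\<^sub>R F i z))) \<le> L * B * h * (\<Sum>i<k. w i)"
      using Suc by auto
    have "(\<Sum>i<Suc k. w i) \<le> (\<Sum>i\<le>m. w i)"
      using k w(1) by (intro sum_mono2) auto
    then have "B * (\<Sum>i<Suc k. w i) \<le> B * h"
      using w(2) B_nonneg by (auto intro: mult_left_mono)
    then have le: "B * (\<Sum>i<k. w i) + B * w k \<le> B * h"
      by (simp add: distrib_left)
    let ?z = "flow (F k) (w k) z'"
    have "norm z' \<le> norm (z' - z) + norm z"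
      by (metis diff_add_cancel norm_triangle_ineq)
    then have R: "norm z' + B * w k \<le> R"
      using z'(2) le z(2) by linarith
    have "0 \<le> B * w k" "0 \<le> B * h"
      using B_nonneg w k sum_nonneg[of "{..m}" w] by auto
    then have zR: "z \<in> cball 0 R"
      using z(2) by auto
    have "norm (?z - z' - w k *\<^sub>R F k z) \<le> L * (norm (z' - z) + B * w k) * w k"
      by (rule flow_increment_approx[OF k w(1)[OF k] L zR R])
    also have "\<dots> \<le> L * (B * h) * w k"
      using L(1) le z'(2) w(1)[OF k] by (intro mult_right_mono mult_left_mono) auto
    finally have step: "norm (?z - z' - w k *\<^sub>R F k z) \<le> L * B * h * w k"
      by (simp add: mult_ac)
    have eq: "?z - (z + (\<Sum>i<Suc k. w i *\<^sub>R F i z)) =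
        (?z - z' - w k *\<^sub>R F k z) + (z' - (z + (\<Sum>i<k. w i *\<^sub>R F i z)))"
      by simp
    have "norm (?z - (z + (\<Sum>i<Suc k. w i *\<^sub>R F i z))) \<le> L * B * h * (\<Sum>i<Suc k. w i)"
      unfolding eq using norm_triangle_le[OF add_mono[OF step z'(3)]]
      by (simp add: distrib_left add.commute)
    moreover have "norm (?z - z) \<le> B * (\<Sum>i<Suc k. w i)"
    proof -
      have "norm (?z - z') \<le> B * w k"
        using norm_phi_le[OF const_controls[OF k] w(1)[OF k], of z']
        by (simp add: flow_eq_phi k w(1))
      then have "norm ((?z - z') + (z' - z)) \<le> B * w k + B * (\<Sum>i<k. w i)"
        using z'(2) by (intro norm_triangle_le add_mono)
      then show ?thesis by (simp add: distrib_left add.commute)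
    qed
    ultimately show ?case
      using inv[OF k w(1)[OF k] z'(1)] by blast
  qed
  from this[of "Suc m"] show ?thesis
    using w(2) by (auto simp: lessThan_Suc_atMost)
qed

text \<open>Relaxation: a relaxed trajectory is followed by switching between the fields quickly. The
  recursion for the distance \<open>d k\<close> to \<open>S\<close> at time \<open>k h\<close> is \<open>d (k+1) \<le> (1 + L h) d k + 2 L B h\<^sup>2\<close>.\<close>

lemma flow_invariant_imp_phi_invariant:
  assumes "closed S" and inv: "\<And>i t y. i \<le> m \<Longrightarrow> 0 \<le> t \<Longrightarrow> y \<in> S \<Longrightarrow> flow (F i) t y \<in> S"
    and x: "x \<in> S" and v: "v \<in> controls m" and T: "0 \<le> T"
  shows "phi m F T x v \<in> S"
proof -
  \<comment> \<open>The trajectory stays within \<open>B * T\<close> of \<open>x\<close>, a nearest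
    point of \<open>S\<close> to it is at most another \<open>B * T\<close> away, and the flows
    started there travel at most a third \<open>B * T\<close>.\<close>
  define R where "R = norm x + 3 * B * T"
  have "0 \<le> B * T" using B_nonneg T by simp
  obtain L where L: "0 < L" "\<And>i y z. i \<le> m \<Longrightarrow> y \<in> cball 0 R \<Longrightarrow> z \<in> cball 0 R \<Longrightarrow>
      norm (F i y - F i z) \<le> L * norm (y - z)"
    using F_lipschitz[of R] by blast
  let ?\<xi> = "\<lambda>t. phi m F t x v"
  have near: "norm (?\<xi> t - x) \<le> B * T" if "t \<in> {0..T}" for t
  proof -
    have "norm (?\<xi> t - x) \<le> B * t" using that by (intro norm_phi_le v) auto
    also have "\<dots> \<le> B * T" using that B_nonneg by (auto intro: mult_left_mono)
    finally show ?thesis .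
  qed
  have "infdist (?\<xi> T) S \<le> 2 * L * B * T * T * exp (L * T) / real n" if "0 < n" for n
  proof -
    define h where "h = T / n"
    have h: "0 \<le> h" "real n * h = T" using T that by (auto simp: h_def)
    \<comment> \<open>This bound solves the recursion: each step contributes twice
      \<open>L * B * h * h\<close>, once from the relaxed trajectory and once from the switched one,
      amplified by at most \<open>(1 + L * h) ^ k\<close>.\<close>
    have "infdist (?\<xi> (real k * h)) S \<le> 2 * L * B * h * h * real k * (1 + L * h) ^ k" if "k \<le> n" for k
      using that
    proof (induction k)
      case 0
      show ?case using x v by simp
    next
      case (Suc k)
      let ?s = "real k * h" and ?t = "real (Suc k) * h"
      have st: "0 \<le> ?s" "?s \<le> ?t" "?t - ?s = h"
        using h by (auto simp: algebra_simps)
      have "?t \<le> real n * h" using Suc h by (intro mult_right_mono) auto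
      then have tT: "?t \<le> T" using h by simp
      \<comment> \<open>The integrated control prescribes how long each field runs during the step;
        these times add up to \<open>h\<close>.\<close>
      define w where "w i = integral {?s..?t} (\<lambda>r. v r i)" for i
      have w: "0 \<le> w i" if "i \<le> m" for i
        unfolding w_def
      proof (rule Henstock_Kurzweil_Integration.integral_nonneg)
        show "(\<lambda>r. v r i) integrable_on {?s..?t}"
          using that st by (intro control_component_integrable[OF v]) auto
        show "0 \<le> v r i" if "r \<in> {?s..?t}" for r
        proof -
          have "0 \<le> r" using that st(1) by (meson atLeastAtMost_iff order_trans)
          then show ?thesis
            using controls_co_S[OF v, of r] \<open>i \<le> m\<close> by (auto simp: co_S_def PiE_iff)
        qed
      qed
      have sum_w: "(\<Sum>i\<le>m. w i) = h"
      proof -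
        have "(\<Sum>i\<le>m. w i) = integral {?s..?t} (\<lambda>r. \<Sum>i\<le>m. v r i)"
          unfolding w_def using st by (subst integral_sum) (auto intro: control_component_integrable[OF v])
        also have "\<dots> = integral {?s..?t} (\<lambda>r. 1)"
        proof (rule Henstock_Kurzweil_Integration.integral_cong)
          fix r assume "r \<in> {?s..?t}"
          then have "0 \<le> r" using st(1) by (meson atLeastAtMost_iff order_trans)
          then show "(\<Sum>i\<le>m. v r i) = 1"
            using controls_co_S[OF v] by (simp add: co_S_def)
        qed
        also have "\<dots> = h" using st by simp
        finally show ?thesis .
      qed
      \<comment> \<open>The comparison restarts at a nearest point of \<open>S\<close>. As
        \<open>x\<close> itself belongs to \<open>S\<close>, this point is no farther from the
        trajectory than \<open>x\<close> is.\<close>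
      obtain z where z: "z \<in> S" "infdist (?\<xi> ?s) S = dist (?\<xi> ?s) z"
        using infdist_attains_inf[OF \<open>closed S\<close>, of "?\<xi> ?s"] x by auto
      have "dist (?\<xi> ?s) z \<le> dist (?\<xi> ?s) x"
        using z x by (metis infdist_le)
      also have "\<dots> \<le> B * T"
        using near[of ?s] st tT by (simp add: dist_norm)
      finally have zs: "norm (?\<xi> ?s - z) \<le> B * T"
        by (simp add: dist_norm)
      have "h \<le> T" using tT st by linarith
      then have "B * h \<le> B * T"
        using B_nonneg by (intro mult_left_mono) auto
      have "norm z \<le> norm x + norm (?\<xi> ?s - x) + norm (?\<xi> ?s - z)"
        by (smt (verit) norm_triangle_sub norm_minus_commute)
      then have "norm z \<le> norm x + 2 * (B * T)"
        using zs near[of ?s] st tT by auto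
      then have zR: "norm z + B * h \<le> R"
        unfolding R_def using \<open>B * h \<le> B * T\<close> by linarith
      have zR': "z \<in> cball 0 R"
        using zR B_nonneg h by (smt (verit) mem_cball_0 mult_nonneg_nonneg)
      obtain z' where z': "z' \<in> S" "norm (z' - (z + (\<Sum>i\<le>m. w i *\<^sub>R F i z))) \<le> L * B * h * h"
        using flow_composition_approx[OF inv L w sum_w z(1) zR] by blast
      have ball: "?\<xi> r \<in> cball 0 R" if "r \<in> {?s..?t}" for r
        proof -
          have "?s \<le> r" "r \<le> ?t" using that by auto
          then have "r \<in> {0..T}" using st(1) tT by (meson atLeastAtMost_iff order_trans)
          then have "norm (?\<xi> r - x) \<le> B * T" by (rule near)
          moreover have "norm (?\<xi> r) \<le> norm x + norm (?\<xi> r - x)"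
            by (metis add.commute diff_add_cancel norm_triangle_ineq)
          ultimately show "?\<xi> r \<in> cball 0 R"
            unfolding R_def mem_cball_0 using \<open>0 \<le> B * T\<close> by linarith
        qed
      have "norm (?\<xi> ?t - ?\<xi> ?s - (\<Sum>i\<le>m. w i *\<^sub>R F i z))
          \<le> L * (norm (?\<xi> ?s - z) + B * (?t - ?s)) * (?t - ?s)"
        unfolding w_def by (rule phi_increment_approx[OF v st(1,2) L zR' ball])
      then have incr: "norm (?\<xi> ?t - ?\<xi> ?s - (\<Sum>i\<le>m. w i *\<^sub>R F i z)) \<le> L * (norm (?\<xi> ?s - z) + B * h) * h"
        by (simp only: st(3))
      have "infdist (?\<xi> ?t) S \<le> norm (?\<xi> ?t - z')"
        using infdist_le[OF z'(1)] by (simp add: dist_norm)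
      also have "\<dots> = norm ((?\<xi> ?t - ?\<xi> ?s - (\<Sum>i\<le>m. w i *\<^sub>R F i z)) + (?\<xi> ?s - z)
          + - (z' - (z + (\<Sum>i\<le>m. w i *\<^sub>R F i z))))"
        by simp
      also have "\<dots> \<le> L * (norm (?\<xi> ?s - z) + B * h) * h + norm (?\<xi> ?s - z) + L * B * h * h"
        using incr z'(2) by (intro norm_triangle_le add_mono) (auto simp: norm_minus_commute)
      also have "\<dots> = (1 + L * h) * infdist (?\<xi> ?s) S + 2 * L * B * h * h"
        unfolding z(2) dist_norm by (simp add: algebra_simps)
      also have "\<dots> \<le> (1 + L * h) * (2 * L * B * h * h * real k * (1 + L * h) ^ k)
          + 2 * L * B * h * h * (1 + L * h) ^ Suc k"
      proof (intro add_mono mult_left_mono)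
        have "1 \<le> (1 + L * h) ^ Suc k"
          using h L(1) by (intro one_le_power) auto
        then have "2 * L * B * h * h * 1 \<le> 2 * L * B * h * h * (1 + L * h) ^ Suc k"
          using h L(1) B_nonneg by (intro mult_left_mono) auto
        then show "2 * L * B * h * h \<le> 2 * L * B * h * h * (1 + L * h) ^ Suc k"
          by simp
      qed (use Suc h L(1) in auto)
      also have "\<dots> = 2 * L * B * h * h * real (Suc k) * (1 + L * h) ^ Suc k"
        by (simp add: algebra_simps)
      finally show ?case .
    qed
    from this[of n] have "infdist (?\<xi> T) S \<le> 2 * L * B * h * h * real n * (1 + L * h) ^ n"
      by (simp add: h)
    also have "\<dots> \<le> 2 * L * B * h * h * real n * exp (L * T)"
    proof (rule mult_left_mono)
      have "(1 + L * h) ^ n \<le> exp (L * h) ^ n"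
        using h L(1) by (intro power_mono) auto
      also have "\<dots> = exp (L * T)"
        by (simp add: h(2)[symmetric] mult_ac flip: exp_of_nat_mult)
      finally show "(1 + L * h) ^ n \<le> exp (L * T)" .
    qed (use h L(1) B_nonneg in auto)
    also have "\<dots> = 2 * L * B * T * T * exp (L * T) / real n"
      using that by (simp add: h_def)
    finally show ?thesis .
  qed
  then have "infdist (?\<xi> T) S \<le> 0"
    by (intro tendsto_lowerbound[OF lim_const_over_n[of "2 * L * B * T * T * exp (L * T)"]])
       (auto simp: eventually_sequentially intro!: exI[of _ 1])
  then have "infdist (?\<xi> T) S = 0"
    using infdist_nonneg[of "?\<xi> T" S] by linarith
  then show ?thesis
    using in_closed_iff_infdist_zero[OF \<open>closed S\<close>] x by auto
qed

section \<open>Orbits and invariant control sets\<close>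

lemma mem_orbit_pos_iff: "y \<in> orbit_pos m F x \<longleftrightarrow> (\<exists>t\<ge>0. \<exists>v\<in>controls m. y = phi m F t x v)"
proof
  assume "\<exists>t\<ge>0. \<exists>v\<in>controls m. y = phi m F t x v"
  then obtain t v where tv: "0 \<le> t" "v \<in> controls m" "y = phi m F t x v" by blast
  \<comment> \<open>The horizon has to be positive even if \<open>t = 0\<close>, hence
    \<open>t + 1\<close>.\<close>
  then have "y \<in> orbit_pos_upto m F (t + 1) x"
    unfolding orbit_pos_upto_def by (intro CollectI exI[of _ t] exI[of _ v]) auto
  then show "y \<in> orbit_pos m F x"
    using tv(1) unfolding orbit_pos_def by (intro UN_I[of "t + 1"]) auto
qed (auto simp: orbit_pos_def orbit_pos_upto_def)

lemma self_in_orbit_pos: "x \<in> orbit_pos m F x"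
  using controls_nonempty phi_0 by (force simp: mem_orbit_pos_iff)

lemma orbit_pos_trans:
  assumes "y \<in> orbit_pos m F x" "z \<in> orbit_pos m F y"
  shows "z \<in> orbit_pos m F x"
proof -
  obtain s v t w where "0 \<le> s" "v \<in> controls m" "y = phi m F s x v"
      "0 \<le> t" "w \<in> controls m" "z = phi m F t y w"
    using assms by (auto simp: mem_orbit_pos_iff)
  then show ?thesis
    using phi_concat[of v w s t x] concat_controls[of v m w s]
    by (auto simp: mem_orbit_pos_iff intro!: exI[of _ "s + t"] bexI[of _ "concat_control s v w"])
qed

text \<open>For a fixed time and control \<open>phi\<close> is continuous in the initial point, so
  it maps the closure of an orbit into itself. This makes approximate reachability
  transitive.\<close>

lemma closure_orbit_pos_subset:
  assumes "y \<in> closure (orbit_pos m F x)"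
  shows "closure (orbit_pos m F y) \<subseteq> closure (orbit_pos m F x)"
proof (rule closure_minimal)
  show "orbit_pos m F y \<subseteq> closure (orbit_pos m F x)"
  proof
    fix z assume "z \<in> orbit_pos m F y"
    then obtain t v where tv: "0 \<le> t" "v \<in> controls m" and z: "z = phi m F t y v"
      by (auto simp: mem_orbit_pos_iff)
    have "(\<lambda>x. phi m F t x v) ` closure (orbit_pos m F x) \<subseteq> closure (orbit_pos m F x)"
    proof (rule image_closure_subset)
      show "continuous_on (closure (orbit_pos m F x)) (\<lambda>x. phi m F t x v)"
        using continuous_phi[OF tv(2,1)] by (rule continuous_on_subset) auto
      show "(\<lambda>x. phi m F t x v) ` orbit_pos m F x \<subseteq> closure (orbit_pos m F x)"
      proof (intro image_subsetI subsetD[OF closure_subset])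
        fix u assume u: "u \<in> orbit_pos m F x"
        show "phi m F t u v \<in> orbit_pos m F x"
          by (rule orbit_pos_trans[OF u]) (use tv in \<open>auto simp: mem_orbit_pos_iff\<close>)
      qed
    qed auto
    then show "z \<in> closure (orbit_pos m F x)"
      using z assms by auto
  qed
qed auto

lemma positively_invariant_iff: "positively_invariant m F A \<longleftrightarrow> (\<forall>x\<in>A. orbit_pos m F x \<subseteq> A)"
  by (fastforce simp: positively_invariant_def mem_orbit_pos_iff)

lemma closure_orbit_pos_subset_invariant:
  assumes "positively_invariant m F A" "closed A" "x \<in> A"
  shows "closure (orbit_pos m F x) \<subseteq> A"
  using assms by (intro closure_minimal) (auto simp: positively_invariant_iff)

lemma positively_invariant_closure_orbit_pos:
  "positively_invariant m F (closure (orbit_pos m F x))"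
  using closure_orbit_pos_subset closure_subset by (fastforce simp: positively_invariant_iff)

lemma control_properties_of_orbit_closures:
  assumes "\<And>x. x \<in> C \<Longrightarrow> closure (orbit_pos m F x) = C"
  shows "controlled_invariant_approx_controllable m F C"
proof -
  have "phi m F t x v \<in> C" if "x \<in> C" "0 \<le> t" "v \<in> controls m" for x t v
  proof -
    have "phi m F t x v \<in> orbit_pos m F x"
      using that by (auto simp: mem_orbit_pos_iff)
    then show ?thesis
      using assms[OF that(1)] closure_subset[of "orbit_pos m F x"] by blast
  qed
  then show ?thesis
    using assms controls_nonempty by (auto simp: controlled_invariant_approx_controllable_def)
qed

text \<open>Maximality is automatic: a competitor \<open>D\<close> containing \<open>C\<close> lies
  in the orbit closure of each of its points, and for a point of \<open>C\<close> this closure is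
  \<open>C\<close>.\<close>

lemma invariant_control_set_of_orbit_closures:
  assumes "C \<noteq> {}" and C: "\<And>x. x \<in> C \<Longrightarrow> closure (orbit_pos m F x) = C"
  shows "invariant_control_set m F C"
proof -
  obtain x where x: "x \<in> C" using \<open>C \<noteq> {}\<close> by blast
  have "D = C" if "controlled_invariant_approx_controllable m F D" "C \<subseteq> D" for D
    using that x C[OF x] by (auto simp: controlled_invariant_approx_controllable_def)
  moreover have "closure C = closure (orbit_pos m F x)" if "x \<in> C" for x
    using C[OF that] by (metis closure_closure)
  ultimately show ?thesis
    using assms control_properties_of_orbit_closures[of C]
    by (auto simp: invariant_control_set_def control_set_def)
qed

text \<open>A minimal nonempty closed positively invariant set is the closure of the orbit of each of its points.\<close>

lemma exists_invariant_control_set: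
  assumes "compact S" "S \<noteq> {}" "positively_invariant m F S"
  shows "\<exists>C\<subseteq>S. invariant_control_set m F C"
proof -
  define \<A> where "\<A> = {K. K \<subseteq> S \<and> K \<noteq> {} \<and> closed K \<and> positively_invariant m F K}"
  \<comment> \<open>Zorn's lemma for maximal elements is applied to complements, which yields a
    minimal member of \<open>\<A>\<close>.\<close>
  have "\<exists>N\<in>uminus ` \<A>. \<forall>X\<in>uminus ` \<A>. N \<subseteq> X \<longrightarrow> X = N"
  proof (rule subset_Zorn_nonempty)
    have "S \<in> \<A>"
      using assms by (simp add: \<A>_def compact_imp_closed)
    then show "uminus ` \<A> \<noteq> {}"
      by blast
    fix \<C> assume "\<C> \<noteq> {}" and chain: "subset.chain (uminus ` \<A>) \<C>"
    let ?\<K> = "uminus ` \<C>"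
    have sub: "?\<K> \<subseteq> \<A>"
      using chain by (auto simp: subset.chain_def)
    \<comment> \<open>A chain of nonempty compact sets has nonempty intersection; this is where
      compactness of \<open>S\<close> enters.\<close>
    have "\<Inter>?\<K> \<noteq> {}"
    proof (rule compact_chain)
      show "compact K" if "K \<in> ?\<K>" for K
      proof -
        have "K \<subseteq> S" "closed K"
          using sub that unfolding \<A>_def by blast+
        then show ?thesis
          using \<open>compact S\<close> by (metis compact_Int_closed inf.absorb_iff2)
      qed
      show "{} \<notin> ?\<K>"
        using sub unfolding \<A>_def by blast
      show "K \<subseteq> K' \<or> K' \<subseteq> K" if "K \<in> ?\<K> \<and> K' \<in> ?\<K>" for K K'
        using chain that unfolding subset_chain_def by blast
    qed
    moreover have "\<Inter>?\<K> \<subseteq> S"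
      using sub \<open>\<C> \<noteq> {}\<close> unfolding \<A>_def by blast
    moreover have "closed (\<Inter>?\<K>)"
      using sub by (intro closed_Inter) (auto simp: \<A>_def)
    moreover have "positively_invariant m F (\<Inter>?\<K>)"
      using sub unfolding \<A>_def positively_invariant_def by blast
    ultimately have "\<Inter>?\<K> \<in> \<A>"
      by (simp add: \<A>_def)
    moreover have "\<Union>\<C> = - \<Inter>?\<K>"
      by auto
    ultimately show "\<Union>\<C> \<in> uminus ` \<A>"
      by blast
  qed
  then obtain C where C: "C \<in> \<A>" and min: "\<And>K. K \<in> \<A> \<Longrightarrow> K \<subseteq> C \<Longrightarrow> K = C"
    by auto
  have "closure (orbit_pos m F x) = C" if "x \<in> C" for x
  proof (rule min)
    show sub: "closure (orbit_pos m F x) \<subseteq> C"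
      using C that by (intro closure_orbit_pos_subset_invariant) (auto simp: \<A>_def)
    show "closure (orbit_pos m F x) \<in> \<A>"
      using sub C positively_invariant_closure_orbit_pos self_in_orbit_pos[of x] closure_subset
      by (fastforce simp: \<A>_def)
  qed
  then have "invariant_control_set m F C"
    using C by (intro invariant_control_set_of_orbit_closures) (auto simp: \<A>_def)
  then show ?thesis
    using C by (auto simp: \<A>_def)
qed

section \<open>Invariant control sets under local accessibility\<close>

lemma orbit_pos_subset_closed_invariant_control_set:
  assumes "invariant_control_set m F C" "closed C" "x \<in> C"
  shows "orbit_pos m F x \<subseteq> C"
  using assms closure_subset by (fastforce simp: invariant_control_set_def)

lemma invariant_control_sets_eq_of_inter:
  assumes "invariant_control_set m F C" "closed C" "invariant_control_set m F D" "closed D"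
    and "C \<inter> D \<noteq> {}"
  shows "C = D"
proof -
  obtain x where "x \<in> C" "x \<in> D" using assms(5) by blast
  then have "closure C = closure D"
    using assms(1,3) unfolding invariant_control_set_def by metis
  then show ?thesis using assms(2,4) by simp
qed

lemma interior_orbit_pos_inter:
  assumes "locally_accessible_on m F M" "x \<in> M" "open U" "x \<in> U"
  shows "interior (orbit_pos m F x) \<inter> U \<noteq> {}"
proof -
  have "interior (orbit_pos_upto m F 1 x) \<inter> U \<noteq> {}"
    using assms by (auto simp: locally_accessible_on_def)
  moreover have "interior (orbit_pos_upto m F 1 x) \<subseteq> interior (orbit_pos m F x)"
    by (intro interior_mono) (auto simp: orbit_pos_def intro!: bexI[of _ 1])
  ultimately show ?thesis by blast
qed

text \<open>The closure of \<open>C\<close> again satisfies the two control properties, so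
  maximality forces it to equal \<open>C\<close>. The point to check is that a boundary point can be
  steered back into \<open>C\<close>: its orbit has interior points, these lie in the closure of
  \<open>C\<close>, and an open set meeting the closure meets \<open>C\<close>.\<close>

lemma accessible_invariant_control_set_closed:
  assumes acc: "locally_accessible_on m F M" and "closed M"
    and C: "invariant_control_set m F C" "C \<subseteq> M"
  shows "closed C"
proof -
  have "closure (orbit_pos m F x) = closure C" if "x \<in> C" for x
    using C(1) that by (auto simp: invariant_control_set_def)
  note orbit = this
  obtain x\<^sub>0 where x\<^sub>0: "x\<^sub>0 \<in> C"
    using C(1) by (auto simp: invariant_control_set_def control_set_def)
  have "closure (orbit_pos m F y) = closure C" if y: "y \<in> closure C" for y
  proof
    show sub: "closure (orbit_pos m F y) \<subseteq> closure C"
      using closure_orbit_pos_subset[of y x\<^sub>0] orbit[OF x\<^sub>0] y by auto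
    have "y \<in> M"
      using y C(2) \<open>closed M\<close> closure_minimal by blast
    then obtain z where z: "z \<in> interior (orbit_pos m F y)"
      using interior_orbit_pos_inter[OF acc, of y UNIV] by auto
    then have "z \<in> closure C"
      using sub interior_subset closure_subset by blast
    then have "interior (orbit_pos m F y) \<inter> C \<noteq> {}"
      using z open_Int_closure_eq_empty[OF open_interior, of "orbit_pos m F y" C] by blast
    then obtain c where "c \<in> orbit_pos m F y" "c \<in> C"
      using interior_subset by blast
    then show "closure C \<subseteq> closure (orbit_pos m F y)"
      using closure_orbit_pos_subset[of c y] orbit[of c] closure_subset by blast
  qed
  then have "controlled_invariant_approx_controllable m F (closure C)"
    by (rule control_properties_of_orbit_closures)
  then have "closure C = C"
    using C(1) closure_subset[of C] unfolding invariant_control_set_def control_set_def by blast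
  then show ?thesis
    by (metis closed_closure)
qed

text \<open>Orbits from \<open>C\<close> remain in the closed set \<open>C\<close> and have interior
  points arbitrarily near their start, so the interior is dense. For exact reachability of
  \<open>y\<close>, approximate controllability leads into the open interior of the backward orbit
  of \<open>y\<close>, and from there some control ends exactly at \<open>y\<close>.\<close>

lemma accessible_invariant_control_set:
  assumes acc: "locally_accessible_on m F M" and "closed M"
    and C: "invariant_control_set m F C" "C \<subseteq> M"
  shows "C = closure (interior C)" and "x \<in> C \<Longrightarrow> interior C \<subseteq> orbit_pos m F x"
proof -
  have clo: "closed C"
    using accessible_invariant_control_set_closed[OF assms] .
  note orbit_sub = orbit_pos_subset_closed_invariant_control_set[OF C(1) clo]
  show "C = closure (interior C)"
  proof
    show "C \<subseteq> closure (interior C)"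
    proof
      fix x assume x: "x \<in> C"
      have "interior C \<inter> U \<noteq> {}" if "open U" "x \<in> U" for U
        using interior_orbit_pos_inter[OF acc _ that] interior_mono[OF orbit_sub[OF x]] C(2) x by blast
      then show "x \<in> closure (interior C)"
        by (auto simp: closure_iff_nhds_not_empty)
    qed
    show "closure (interior C) \<subseteq> C"
      using clo interior_subset by (intro closure_minimal)
  qed
  show "interior C \<subseteq> orbit_pos m F x" if x: "x \<in> C"
  proof
    fix y assume y: "y \<in> interior C"
    then have "y \<in> M" using C(2) interior_subset by blast
    then have "interior (orbit_neg_upto m F 1 y) \<inter> interior C \<noteq> {}"
      using acc y by (auto simp: locally_accessible_on_def)
    then obtain z where "z \<in> interior (orbit_neg_upto m F 1 y)" "z \<in> C"
      using interior_subset by blast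
    moreover have "C \<subseteq> closure (orbit_pos m F x)"
      using C(1) x closure_subset by (auto simp: invariant_control_set_def)
    ultimately have "interior (orbit_neg_upto m F 1 y) \<inter> orbit_pos m F x \<noteq> {}"
      using open_Int_closure_eq_empty[OF open_interior, of "orbit_neg_upto m F 1 y" "orbit_pos m F x"] by blast
    then obtain u where u: "u \<in> orbit_neg_upto m F 1 y" "u \<in> orbit_pos m F x"
      using interior_subset by blast
    then have "y \<in> orbit_pos m F u"
      unfolding orbit_neg_upto_def mem_orbit_pos_iff using atLeastAtMost_iff by blast
    then show "y \<in> orbit_pos m F x"
      using u orbit_pos_trans by blast
  qed
qed

text \<open>Every point of \<open>M\<close> can be steered into the interior of some invariant control set, hence has a
  neighbourhood that meets no other one.\<close>

lemma accessible_finite_invariant_control_sets: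
  assumes acc: "locally_accessible_on m F M" and "compact M" "positively_invariant m F M"
  shows "finite (invariant_control_sets_in m F M)"
proof -
  let ?I = "invariant_control_sets_in m F M"
  have "closed M" using \<open>compact M\<close> by (rule compact_imp_closed)
  have clo: "closed C" if "C \<in> ?I" for C
    using that accessible_invariant_control_set_closed[OF acc \<open>closed M\<close>]
    by (auto simp: invariant_control_sets_in_def)
  have "\<exists>U C. open U \<and> x \<in> U \<and> (\<forall>D\<in>?I. D \<inter> U \<noteq> {} \<longrightarrow> D = C)" if x: "x \<in> M" for x
  proof -
    let ?K = "closure (orbit_pos m F x)"
    have KM: "?K \<subseteq> M"
      using closure_orbit_pos_subset_invariant[OF assms(3) \<open>closed M\<close> x] .
    have "compact ?K"
      using KM \<open>compact M\<close> by (metis closed_closure compact_Int_closed inf.absorb_iff2)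
    moreover have "?K \<noteq> {}"
      using self_in_orbit_pos by auto
    ultimately obtain C where C: "C \<subseteq> ?K" "invariant_control_set m F C"
      using exists_invariant_control_set positively_invariant_closure_orbit_pos by blast
    then have CI: "C \<in> ?I"
      using KM by (auto simp: invariant_control_sets_in_def)
    have "C = closure (interior C)"
      using accessible_invariant_control_set(1)[OF acc \<open>closed M\<close> C(2)] C(1) KM by blast
    moreover have "C \<noteq> {}"
      using C(2) by (auto simp: invariant_control_set_def control_set_def)
    ultimately have "interior C \<noteq> {}"
      by auto
    then have "interior C \<inter> ?K \<noteq> {}"
      using C(1) interior_subset by blast
    then have "interior C \<inter> orbit_pos m F x \<noteq> {}"
      by (simp add: open_Int_closure_eq_empty)
    then obtain t v where tv: "0 \<le> t" "v \<in> controls m" "phi m F t x v \<in> interior C"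
      by (auto simp: mem_orbit_pos_iff)
    \<comment> \<open>On \<open>U\<close> the same time and control lead into the interior of
      \<open>C\<close>. A closed invariant control set meeting \<open>U\<close> keeps such an
      endpoint, hence intersects \<open>C\<close> and equals it.\<close>
    define U where "U = (\<lambda>y. phi m F t y v) -` interior C"
    have "open U"
      unfolding U_def using continuous_phi[OF tv(2,1)] by (rule open_vimage[OF open_interior])
    moreover have "x \<in> U" using tv by (simp add: U_def)
    moreover have "D = C" if "D \<in> ?I" "D \<inter> U \<noteq> {}" for D
    proof -
      obtain y where y: "y \<in> D" "phi m F t y v \<in> interior C"
        using \<open>D \<inter> U \<noteq> {}\<close> by (auto simp: U_def)
      have D: "invariant_control_set m F D"
        using that by (simp add: invariant_control_sets_in_def)
      have "phi m F t y v \<in> D"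
        using orbit_pos_subset_closed_invariant_control_set[OF D clo[OF that(1)] y(1)] tv(1,2)
          mem_orbit_pos_iff by blast
      then show ?thesis
        using invariant_control_sets_eq_of_inter[OF D clo[OF that(1)] C(2) clo[OF CI]] y(2) interior_subset
        by blast
    qed
    ultimately show ?thesis by blast
  qed
  then obtain U C where U: "\<And>x. x \<in> M \<Longrightarrow> open (U x)" "\<And>x. x \<in> M \<Longrightarrow> x \<in> U x"
    and C: "\<And>x D. x \<in> M \<Longrightarrow> D \<in> ?I \<Longrightarrow> D \<inter> U x \<noteq> {} \<Longrightarrow> D = C x"
    by metis
  have "M \<subseteq> (\<Union>x\<in>M. U x)"
    using U(2) by blast
  then obtain M' where M': "M' \<subseteq> M" "finite M'" "M \<subseteq> (\<Union>x\<in>M'. U x)"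
    using compactE_image[OF \<open>compact M\<close>, of M U] U(1) by metis
  have "?I \<subseteq> C ` M'"
  proof
    fix D assume D: "D \<in> ?I"
    then have "D \<noteq> {}" "D \<subseteq> M"
      by (auto simp: invariant_control_sets_in_def invariant_control_set_def control_set_def)
    then obtain x where "x \<in> M'" "D \<inter> U x \<noteq> {}"
      using M'(3) by blast
    then show "D \<in> C ` M'"
      using C[OF _ D] M'(1) by blast
  qed
  then show ?thesis
    using M'(2) finite_surj by blast
qed

end

section \<open>Stationary switching\<close>

lemma poisson_processD:
  assumes "poisson_process P rate N"
  shows "0 \<le> t \<Longrightarrow> N t \<in> measurable P (count_space UNIV)"
    and "\<omega> \<in> space P \<Longrightarrow> N 0 \<omega> = 0"
    and "\<omega> \<in> space P \<Longrightarrow> 0 \<le> s \<Longrightarrow> s \<le> t \<Longrightarrow> N s \<omega> \<le> N t \<omega>"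
  using assms by (auto simp: poisson_process_def mono_on_def)

lemma poisson_process_prob_0:
  assumes P: "prob_space P" "poisson_process P rate N" and "0 < rate" "0 \<le> t"
  shows "measure P {\<omega>\<in>space P. N t \<omega> = 0} = exp (- (rate * t))"
\<comment> \<open>The law of increments is prescribed only over intervals of positive
  length.\<close>
proof (cases "t = 0")
  case True
  then have "{\<omega>\<in>space P. N t \<omega> = 0} = space P"
    using poisson_processD(2)[OF P(2)] by auto
  then show ?thesis
    using True prob_space.prob_space[OF P(1)] by simp
next
  case False
  have N: "N t \<in> measurable P (count_space UNIV)" "N 0 \<in> measurable P (count_space UNIV)"
    using poisson_processD(1)[OF P(2)] \<open>0 \<le> t\<close> by auto
  then have meas: "(\<lambda>\<omega>. N t \<omega> - N 0 \<omega>) \<in> measurable P (count_space UNIV)"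
    by measurable
  have "measure P {\<omega>\<in>space P. N t \<omega> = 0} = measure P ((\<lambda>\<omega>. N t \<omega> - N 0 \<omega>) -` {0} \<inter> space P)"
    using poisson_processD(2)[OF P(2)] by (intro arg_cong[of _ _ "measure P"]) auto
  also have "\<dots> = measure (distr P (count_space UNIV) (\<lambda>\<omega>. N t \<omega> - N 0 \<omega>)) {0}"
    using meas by (simp add: measure_distr)
  also have "distr P (count_space UNIV) (\<lambda>\<omega>. N t \<omega> - N 0 \<omega>) = measure_pmf (poisson_pmf (rate * (t - 0)))"
    using P(2) False \<open>0 \<le> t\<close> unfolding poisson_process_def by (metis less_le order_refl)
  also have "measure (measure_pmf (poisson_pmf (rate * (t - 0)))) {0} = exp (- (rate * t))"
    using False assms by (simp add: measure_pmf_single)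
  finally show ?thesis .
qed

text \<open>The event is a difference of nested no-jump events, of probability
  \<open>exp (- (rate * a)) - exp (- (rate * b))\<close>. It stands in for the event that the first
  jump time lies in a given interval, without computing the law of that time.\<close>

lemma poisson_process_prob_first_jump:
  assumes P: "prob_space P" "poisson_process P rate N" and "0 < rate" "0 \<le> a" "a < b"
  shows "0 < measure P {\<omega>\<in>space P. N a \<omega> = 0 \<and> 1 \<le> N b \<omega>}"
proof -
  interpret prob_space P by fact
  have [measurable]: "N a \<in> measurable P (count_space UNIV)" "N b \<in> measurable P (count_space UNIV)"
    using poisson_processD(1)[OF P(2)] assms by auto
  have "{\<omega>\<in>space P. N a \<omega> = 0 \<and> 1 \<le> N b \<omega>} = {\<omega>\<in>space P. N a \<omega> = 0} - {\<omega>\<in>space P. N b \<omega> = 0}"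
    by auto
  moreover have "{\<omega>\<in>space P. N b \<omega> = 0} \<subseteq> {\<omega>\<in>space P. N a \<omega> = 0}"
  proof
    fix \<omega> assume "\<omega> \<in> {\<omega>\<in>space P. N b \<omega> = 0}"
    then show "\<omega> \<in> {\<omega>\<in>space P. N a \<omega> = 0}"
      using poisson_processD(3)[OF P(2), of \<omega> a b] assms by auto
  qed
  ultimately have "measure P {\<omega>\<in>space P. N a \<omega> = 0 \<and> 1 \<le> N b \<omega>} = exp (- (rate * a)) - exp (- (rate * b))"
    using poisson_process_prob_0[OF P] assms by (simp add: finite_measure_Diff)
  then show ?thesis
    using assms by simp
qed

text \<open>On a path without jumps the first jump time is the infimum of the empty set. Such paths
  have probability at most \<open>exp (- rate) ^ n\<close> for every \<open>n\<close>.\<close>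

lemma poisson_process_AE_jump:
  assumes P: "prob_space P" "poisson_process P rate N" and "0 < rate"
  shows "AE \<omega> in P. \<exists>t\<ge>0. 1 \<le> N t \<omega>"
proof -
  interpret prob_space P by fact
  have [measurable]: "N (real n) \<in> measurable P (count_space UNIV)" for n
    using poisson_processD(1)[OF P(2)] by auto
  let ?A = "{\<omega>\<in>space P. \<forall>n. N (real n) \<omega> = 0}"
  have A: "?A \<in> sets P" by measurable
  have "measure P ?A \<le> exp (- rate) ^ n" for n
  proof -
    have "measure P ?A \<le> measure P {\<omega>\<in>space P. N (real n) \<omega> = 0}"
      by (intro finite_measure_mono) auto
    also have "\<dots> = exp (- rate) ^ n"
      using poisson_process_prob_0[OF P \<open>0 < rate\<close>, of "real n"] by (simp add: mult.commute flip: exp_of_nat_mult)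
    finally show ?thesis .
  qed
  moreover have "(\<lambda>n. exp (- rate) ^ n) \<longlonglongrightarrow> 0"
    using \<open>0 < rate\<close> by (intro LIMSEQ_realpow_zero) auto
  ultimately have "measure P ?A \<le> 0"
    by (intro tendsto_lowerbound) auto
  then have "measure P ?A = 0"
    using measure_nonneg[of P ?A] by linarith
  then have "AE \<omega> in P. \<not> (\<forall>n. N (real n) \<omega> = 0)"
    using A by (intro AE_I[of _ _ ?A]) (auto simp: emeasure_eq_measure)
  then show ?thesis
    by (rule AE_mp) (auto intro!: AE_I2 simp: Suc_le_eq intro: of_nat_0_le_iff)
qed

lemma jump_time_0: "jump_time N 0 \<omega> = 0"
  by (simp add: jump_time_def flip: atLeast_def)

lemma interjump_time_1_nonneg:
  assumes "\<exists>t\<ge>0. 1 \<le> N t \<omega>"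
  shows "0 \<le> interjump_time N (Suc 0) \<omega>"
proof -
  have "0 \<le> Inf {t. 0 \<le> t \<and> Suc 0 \<le> N t \<omega>}"
    using assms by (intro cInf_greatest) auto
  then show ?thesis
    by (simp add: interjump_time_def jump_time_0) (simp add: jump_time_def)
qed

lemma interjump_time_1_bounds:
  assumes N: "poisson_process P rate N" "\<omega> \<in> space P" and ab: "0 \<le> a" "0 \<le> b"
    and "N a \<omega> = 0" "1 \<le> N b \<omega>"
  shows "interjump_time N (Suc 0) \<omega> \<in> {a..b}"
proof -
  let ?X = "{t. 0 \<le> t \<and> Suc 0 \<le> N t \<omega>}"
  have b: "b \<in> ?X" using assms by auto
  have a: "a \<le> t" if "t \<in> ?X" for t
  proof (rule ccontr)
    assume "\<not> a \<le> t"
    then have "N t \<omega> \<le> N a \<omega>"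
      using that by (intro poisson_processD(3)[OF N]) auto
    then show False using that assms by auto
  qed
  have "Inf ?X \<le> b"
    using b a by (intro cInf_lower bdd_belowI[of _ a]) auto
  moreover have "a \<le> Inf ?X"
    using b a by (intro cInf_greatest) auto
  ultimately show ?thesis
    by (simp add: interjump_time_def jump_time_0) (simp add: jump_time_def)
qed

section \<open>Positive entries of stochastic matrices\<close>

lemma matrix_power_nonneg:
  assumes "transition_matrix m A" "i \<le> m" "j \<le> m"
  shows "0 \<le> matrix_power m A n i j"
  using assms(2,3)
proof (induction n arbitrary: j)
  case (Suc n)
  then show ?case
    using assms(1) by (auto simp: transition_matrix_def intro!: sum_nonneg mult_nonneg_nonneg)
qed auto

text \<open>A positive sum of nonnegative terms has a positive term. This peels the last transition
  off a path of positive probability.\<close>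

lemma matrix_power_Suc_posD:
  assumes A: "transition_matrix m A" and "i \<le> m" "j \<le> m" and pos: "0 < matrix_power m A (Suc n) i j"
  shows "\<exists>k\<le>m. 0 < matrix_power m A n i k \<and> 0 < A k j"
proof (rule ccontr)
  assume neg: "\<not> ?thesis"
  have "matrix_power m A n i k * A k j \<le> 0" if "k \<le> m" for k
  proof -
    have "0 \<le> A k j" using A that assms(3) by (auto simp: transition_matrix_def)
    moreover have "0 \<le> matrix_power m A n i k" using matrix_power_nonneg[OF A \<open>i \<le> m\<close> that] .
    ultimately show ?thesis using neg that by (metis less_le mult_eq_0_iff order_refl)
  qed
  then have "matrix_power m A (Suc n) i j \<le> 0"
    by (auto intro: sum_nonpos)
  then show False using pos by simp
qed

lemma transition_matrix_row_pos:
  assumes "transition_matrix m A" "i \<le> m"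
  shows "\<exists>j\<le>m. 0 < A i j"
proof (rule ccontr)
  assume "\<not> ?thesis"
  then have "(\<Sum>j\<le>m. A i j) \<le> 0"
    by (intro sum_nonpos) auto
  then show False
    using assms by (auto simp: transition_matrix_def)
qed

lemma space_state_space [simp]: "space (state_space m M) = M \<times> {..m}"
  by (simp add: state_space_def space_restrict_space)

lemma state_space_sets: "S \<in> sets borel \<Longrightarrow> S \<inter> (M \<times> {..m}) \<in> sets (state_space m M)"
  by (auto simp: state_space_def sets_restrict_space)

locale stationary_switching_chain = bounded_fields m F B
  for m and F :: "nat \<Rightarrow> 'a \<Rightarrow> 'a::euclidean_space" and B +
  fixes M :: "'a set" and Q :: "'a \<Rightarrow> nat \<Rightarrow> nat \<Rightarrow> real" and rate :: real
    and P :: "'w measure" and N :: "real \<Rightarrow> 'w \<Rightarrow> nat" and Z :: "nat \<Rightarrow> 'w \<Rightarrow> 'a \<times> nat"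
    and \<mu> :: "('a \<times> nat) measure"
  assumes compact_M: "compact M" and invariant_M: "positively_invariant m F M"
    and continuous_Q: "\<And>i j. i \<le> m \<Longrightarrow> j \<le> m \<Longrightarrow> continuous_on UNIV (\<lambda>x. Q x i j)"
    and transition_Q: "\<And>x. transition_matrix m (Q x)"
    and irreducible_Q: "\<And>x. irreducible_aperiodic m (Q x)"
    and rate_pos: "0 < rate"
    and invariant_\<mu>: "invariant_measure m F Q rate M P N Z \<mu>"
begin

section \<open>Stationarity and absorbing sets\<close>

lemma chain: "switching_chain m F Q rate M P N Z"
  using invariant_\<mu> by (simp add: invariant_measure_def)

lemma distr_Z: "distr P (state_space m M) (Z n) = \<mu>"
  using invariant_\<mu> by (simp add: invariant_measure_def)

lemma P_poisson: "poisson_process P rate N"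
  using chain by (simp add: switching_chain_def)

lemma Z_measurable: "Z n \<in> measurable P (state_space m M)"
  using chain by (simp add: switching_chain_def)

sublocale prob_space P
  using chain by (simp add: switching_chain_def)

lemma Z_in_space: "\<omega> \<in> space P \<Longrightarrow> Z n \<omega> \<in> M \<times> {..m}"
  using measurable_space[OF Z_measurable] by fastforce

lemma Z_event: "S \<in> sets borel \<Longrightarrow> {\<omega>\<in>space P. Z n \<omega> \<in> S} \<in> events"
proof -
  assume "S \<in> sets borel"
  from measurable_sets[OF Z_measurable state_space_sets[OF this]]
  show ?thesis
    by (rule back_subst[of "\<lambda>A. A \<in> events"]) (use Z_in_space in auto)
qed

lemma prob_Z:
  assumes "S \<in> sets borel"
  shows "prob {\<omega>\<in>space P. Z n \<omega> \<in> S} = measure \<mu> (S \<inter> (M \<times> {..m}))"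
proof -
  have "measure \<mu> (S \<inter> (M \<times> {..m})) = prob (Z n -` (S \<inter> (M \<times> {..m})) \<inter> space P)"
    by (subst distr_Z[of n, symmetric]) (rule measure_distr[OF Z_measurable state_space_sets[OF assms]])
  also have "Z n -` (S \<inter> (M \<times> {..m})) \<inter> space P = {\<omega>\<in>space P. Z n \<omega> \<in> S}"
    using Z_in_space by auto
  finally show ?thesis by simp
qed

lemma prob_Z_stationary: "S \<in> sets borel \<Longrightarrow> prob {\<omega>\<in>space P. Z n \<omega> \<in> S} = prob {\<omega>\<in>space P. Z k \<omega> \<in> S}"
  by (simp add: prob_Z)

lemma space_\<mu>: "space \<mu> = M \<times> {..m}"
  using distr_Z[of 0] by (metis space_distr space_state_space)

lemma AE_X1: "AE \<omega> in P. 0 \<le> interjump_time N 1 \<omega> \<and>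
    fst (Z 1 \<omega>) = flow (F (snd (Z 0 \<omega>))) (interjump_time N 1 \<omega>) (fst (Z 0 \<omega>))"
proof (rule AE_conjI)
  show "AE \<omega> in P. 0 \<le> interjump_time N 1 \<omega>"
    using poisson_process_AE_jump[OF prob_space_axioms P_poisson rate_pos]
    by eventually_elim (simp add: interjump_time_1_nonneg)
  show "AE \<omega> in P. fst (Z 1 \<omega>) = flow (F (snd (Z 0 \<omega>))) (interjump_time N 1 \<omega>) (fst (Z 0 \<omega>))"
    using chain by (auto simp: switching_chain_def dest!: spec[where x = 0])
qed

lemma AE_absorbing_backward:
  assumes "closed K" and inv: "\<And>i t x. i \<le> m \<Longrightarrow> 0 \<le> t \<Longrightarrow> x \<in> K \<Longrightarrow> flow (F i) t x \<in> K"
  shows "AE \<omega> in P. fst (Z 1 \<omega>) \<in> K \<longrightarrow> fst (Z 0 \<omega>) \<in> K"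
proof -
  let ?S = "\<lambda>n. {\<omega>\<in>space P. Z n \<omega> \<in> K \<times> UNIV}"
  have KU: "K \<times> (UNIV :: nat set) \<in> sets borel"
    using \<open>closed K\<close> by (intro borel_closed closed_Times) auto
  have S: "?S n \<in> events" for n
    using Z_event[OF KU] .
  \<comment> \<open>The set \<open>K\<close> is kept by the flows, but the flow recursion holds only
    almost surely, so the inclusion of events is phrased as an almost sure equivalence.\<close>
  have "AE \<omega> in P. \<omega> \<in> ?S 0 \<inter> ?S 1 \<longleftrightarrow> \<omega> \<in> ?S 0"
    using AE_X1
  proof (rule AE_mp, intro AE_I2 impI)
    fix \<omega> assume "\<omega> \<in> space P" and X1: "0 \<le> interjump_time N 1 \<omega> \<and>
      fst (Z 1 \<omega>) = flow (F (snd (Z 0 \<omega>))) (interjump_time N 1 \<omega>) (fst (Z 0 \<omega>))"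
    then show "\<omega> \<in> ?S 0 \<inter> ?S 1 \<longleftrightarrow> \<omega> \<in> ?S 0"
      using Z_in_space[of \<omega> 0] inv[of "snd (Z 0 \<omega>)" "interjump_time N 1 \<omega>" "fst (Z 0 \<omega>)"]
      by (auto simp: mem_Times_iff)
  qed
  then have "prob (?S 0 \<inter> ?S 1) = prob (?S 0)"
    using S by (intro measure_eq_AE) auto
  also have "\<dots> = prob (?S 1)"
    by (rule prob_Z_stationary[OF KU])
  finally have "prob (?S 1 - ?S 0) = 0"
    using S finite_measure_Diff'[of "?S 1" "?S 0"] by (simp add: Int_commute)
  then have "AE \<omega> in P. \<omega> \<notin> ?S 1 - ?S 0"
    using S by (intro AE_not_in null_setsI) (auto simp: emeasure_eq_measure)
  then show ?thesis
    by (rule AE_mp) (auto simp: mem_Times_iff intro!: AE_I2)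
qed

text \<open>Among the states in \<open>M \<times> {..m}\<close>, those failing this are the support
  points of \<mu> restricted to the complement of \<open>K \<times> UNIV\<close>. States over
  interior points of \<open>K\<close> satisfy it trivially.\<close>

definition locally_null_outside :: "'a set \<Rightarrow> 'a \<times> nat \<Rightarrow> bool" where
  "locally_null_outside K z \<longleftrightarrow> (\<exists>V. open V \<and> z \<in> V \<and> prob {\<omega>\<in>space P. Z 0 \<omega> \<in> V - K \<times> UNIV} = 0)"

lemma open_locally_null_outside: "open {z. locally_null_outside K z}"
proof -
  have "{z. locally_null_outside K z} = \<Union>{V. open V \<and> prob {\<omega>\<in>space P. Z 0 \<omega> \<in> V - K \<times> UNIV} = 0}"
    by (auto simp: locally_null_outside_def)
  then show ?thesis by auto
qed

section \<open>The first transition conditioned on the past\<close>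

lemma past_function_measurable:
  "(\<lambda>\<omega>. (\<lambda>k\<in>{..n}. Z k \<omega>, counting_path N \<omega>)) \<in> measurable P (Pi\<^sub>M {..n} (\<lambda>_. state_space m M) \<Otimes>\<^sub>M path_space)"
  unfolding counting_path_def path_space_def
  using Z_measurable poisson_processD(1)[OF P_poisson] by (intro measurable_Pair measurable_restrict) auto

lemma past_subalgebra: "subalgebra P (past_algebra m M P N Z n)"
proof -
  have "(\<lambda>\<omega>. (\<lambda>k\<in>{..n}. Z k \<omega>, counting_path N \<omega>))
      \<in> space P \<rightarrow> space (Pi\<^sub>M {..n} (\<lambda>_. state_space m M) \<Otimes>\<^sub>M path_space)"
    using measurable_space[OF past_function_measurable] by blast
  from sets_vimage_algebra2[OF this] show ?thesis
    using measurable_sets[OF past_function_measurable] unfolding subalgebra_def past_algebra_def by auto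
qed

lemma path_event:
  assumes "0 \<le> a" "0 \<le> b"
  shows "{p\<in>space path_space. p a = 0 \<and> (1::nat) \<le> p b} \<in> sets path_space"
proof -
  have [measurable]: "(\<lambda>p. p a) \<in> measurable path_space (count_space UNIV)"
    "(\<lambda>p. p b) \<in> measurable path_space (count_space UNIV)"
    unfolding path_space_def using assms by (auto intro: measurable_component_singleton)
  show ?thesis by measurable
qed

lemma counting_path_in_space: "counting_path N \<omega> \<in> space path_space"
  by (auto simp: counting_path_def path_space_def space_PiM)

text \<open>The condition on the two counts is the preimage of a path event under
  \<open>counting_path\<close>, so independence of the initial state and the Poisson path
  applies.\<close>

lemma prob_start_and_first_jump:
  assumes S: "S \<in> sets borel" and ab: "0 \<le> a" "0 \<le> b"
  shows "prob {\<omega>\<in>space P. Z 0 \<omega> \<in> S \<and> N a \<omega> = 0 \<and> 1 \<le> N b \<omega>} =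
    prob {\<omega>\<in>space P. Z 0 \<omega> \<in> S} * prob {\<omega>\<in>space P. N a \<omega> = 0 \<and> 1 \<le> N b \<omega>}"
proof -
  let ?W = "{\<omega>\<in>space P. Z 0 \<omega> \<in> S}" and ?E = "{\<omega>\<in>space P. N a \<omega> = 0 \<and> 1 \<le> N b \<omega>}"
  have "Z 0 -` (S \<inter> (M \<times> {..m})) \<inter> space P \<in> sets (vimage_algebra (space P) (Z 0) (state_space m M))"
    by (intro in_vimage_algebra state_space_sets S)
  also have "Z 0 -` (S \<inter> (M \<times> {..m})) \<inter> space P = ?W"
    using Z_in_space by auto
  finally have W: "?W \<in> sets (vimage_algebra (space P) (Z 0) (state_space m M))" .
  have "counting_path N -` {p\<in>space path_space. p a = 0 \<and> 1 \<le> p b} \<inter> space P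
      \<in> sets (vimage_algebra (space P) (counting_path N) path_space)"
    by (intro in_vimage_algebra path_event ab)
  also have "counting_path N -` {p\<in>space path_space. p a = 0 \<and> 1 \<le> p b} \<inter> space P = ?E"
    using counting_path_in_space ab by (auto simp: counting_path_def)
  finally have "prob (?W \<inter> ?E) = prob ?W * prob ?E"
    using chain W unfolding switching_chain_def by (blast intro: indep_setD)
  moreover have "?W \<inter> ?E = {\<omega>\<in>space P. Z 0 \<omega> \<in> S \<and> N a \<omega> = 0 \<and> 1 \<le> N b \<omega>}"
    by auto
  ultimately show ?thesis by simp
qed

text \<open>Such an event involves only \<open>Z 0\<close> and the Poisson path, so it is known
  before the first mark is drawn and conditional expectations may be integrated over it.\<close>

lemma past_event:
  assumes S: "S \<in> sets borel" and ab: "0 \<le> a" "0 \<le> b"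
  shows "{\<omega>\<in>space P. Z 0 \<omega> \<in> S \<and> N a \<omega> = 0 \<and> 1 \<le> N b \<omega>} \<in> sets (past_algebra m M P N Z 0)"
proof -
  let ?f = "\<lambda>\<omega>. (\<lambda>k\<in>{..0}. Z k \<omega>, counting_path N \<omega>)"
  let ?A = "{z\<in>space (Pi\<^sub>M {..0::nat} (\<lambda>_. state_space m M)). z 0 \<in> S \<inter> (M \<times> {..m})}"
  let ?B = "{p\<in>space path_space. p a = 0 \<and> (1::nat) \<le> p b}"
  have "?A \<in> sets (Pi\<^sub>M {..0} (\<lambda>_. state_space m M))"
    using state_space_sets[OF S] by measurable
  then have "?f -` (?A \<times> ?B) \<inter> space P \<in> sets (past_algebra m M P N Z 0)"
    unfolding past_algebra_def by (intro in_vimage_algebra pair_measureI path_event ab)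
  also have "?f -` (?A \<times> ?B) \<inter> space P = {\<omega>\<in>space P. Z 0 \<omega> \<in> S \<and> N a \<omega> = 0 \<and> 1 \<le> N b \<omega>}"
    using counting_path_in_space Z_in_space ab by (auto simp: counting_path_def space_PiM)
  finally show ?thesis .
qed

text \<open>Integrating the conditional probability of mark \<open>j\<close> over \<open>G\<close>
  gives the probability of \<open>G\<close> together with that mark, which is 0. An integrand that
  is positive almost everywhere on \<open>G\<close> has integral 0 only if \<open>G\<close> is
  null.\<close>

lemma AE_mark_positive:
  assumes G: "G \<in> sets (past_algebra m M P N Z 0)" and "j \<le> m"
    and null: "prob {\<omega>\<in>G. snd (Z 1 \<omega>) = j} = 0"
    and pos: "AE \<omega> in P. \<omega> \<in> G \<longrightarrow> 0 < Q (fst (Z 1 \<omega>)) (snd (Z 0 \<omega>)) j"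
  shows "prob G = 0"
proof -
  interpret past: finite_measure_subalgebra P "past_algebra m M P N Z 0"
    by unfold_locales (rule past_subalgebra)
  let ?f = "indicator {\<omega>. snd (Z 1 \<omega>) = j} :: 'w \<Rightarrow> real"
  let ?c = "real_cond_exp P (past_algebra m M P N Z 0) ?f"
  have GP: "G \<in> events"
    using G past_subalgebra by (auto simp: subalgebra_def)
  have J: "{\<omega>\<in>space P. snd (Z 1 \<omega>) = j} \<in> events"
    using Z_event[of "UNIV \<times> {j}" 1] by (auto simp: mem_Times_iff closed_Times)
  have f: "integrable P ?f"
  proof (rule Bochner_Integration.integrable_cong[THEN iffD1, OF refl])
    show "integrable P (indicator {\<omega>\<in>space P. snd (Z 1 \<omega>) = j} :: 'w \<Rightarrow> real)"
      using J by (intro integrable_real_indicator) (auto simp: emeasure_eq_measure)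
  qed (auto simp: indicator_def)
  have c: "AE \<omega> in P. ?c \<omega> = Q (fst (Z 1 \<omega>)) (snd (Z 0 \<omega>)) j"
    using chain \<open>j \<le> m\<close> by (auto simp: switching_chain_def dest!: spec[where x = 0])
  have "(\<integral>\<omega>\<in>G. ?c \<omega> \<partial>P) = (\<integral>\<omega>\<in>G. ?f \<omega> \<partial>P)"
    by (rule past.real_cond_exp_intA[OF f G, symmetric])
  also have "\<dots> = (\<integral>\<omega>. indicator {\<omega>\<in>G. snd (Z 1 \<omega>) = j} \<omega> \<partial>P)"
    unfolding set_lebesgue_integral_def by (intro Bochner_Integration.integral_cong) (auto simp: indicator_def)
  also have "\<dots> = prob {\<omega>\<in>G. snd (Z 1 \<omega>) = j}"
  proof -
    have "{\<omega>\<in>G. snd (Z 1 \<omega>) = j} = G \<inter> {\<omega>\<in>space P. snd (Z 1 \<omega>) = j}"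
      using sets.sets_into_space[OF GP] by auto
    then show ?thesis using GP J by simp
  qed
  finally have int0: "(\<integral>\<omega>. indicator G \<omega> *\<^sub>R ?c \<omega> \<partial>P) = 0"
    using null by (simp add: set_lebesgue_integral_def)
  have "AE \<omega> in P. indicator G \<omega> *\<^sub>R ?c \<omega> = 0"
  proof (subst integral_nonneg_eq_0_iff_AE[symmetric])
    show "integrable P (\<lambda>\<omega>. indicator G \<omega> *\<^sub>R ?c \<omega>)"
      by (intro integrable_mult_indicator GP past.real_cond_exp_int f)
    show "AE \<omega> in P. 0 \<le> indicator G \<omega> *\<^sub>R ?c \<omega>"
      using c pos by eventually_elim (auto simp: indicator_def)
  qed (rule int0)
  then have "AE \<omega> in P. \<omega> \<notin> G"
    using c pos by eventually_elim (auto simp: indicator_def split: if_splits)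
  then show ?thesis
    using AE_iff_null_sets[OF GP] by (auto simp: null_sets_def emeasure_eq_measure)
qed

section \<open>Backward propagation of local nullness\<close>

lemma flow_in_M: "i \<le> m \<Longrightarrow> 0 \<le> t \<Longrightarrow> x \<in> M \<Longrightarrow> flow (F i) t x \<in> M"
  using invariant_M const_controls by (simp add: flow_eq_phi positively_invariant_def)

lemma flow_jointly_continuous:
  assumes "i \<le> m" "0 \<le> u" "open U" "flow (F i) u x \<in> U"
  shows "\<exists>\<epsilon>>0. \<forall>y\<in>ball x \<epsilon>. \<forall>t\<in>{max 0 (u - \<epsilon>)..u + \<epsilon>}. flow (F i) t y \<in> U"
proof -
  obtain r where "0 < r" and r: "ball (flow (F i) u x) r \<subseteq> U"
    using assms(3,4) open_contains_ball by blast
  obtain C where "0 < C" and C: "\<And>y z v. y \<in> cball 0 (norm x + 1) \<Longrightarrow> z \<in> cball 0 (norm x + 1) \<Longrightarrow>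
      v \<in> controls m \<Longrightarrow> norm (phi m F u y v - phi m F u z v) \<le> C * norm (y - z)"
    using phi_space_lipschitz[of "norm x + 1" u] \<open>0 \<le> u\<close> by auto
  \<comment> \<open>A time shift costs at most \<open>B * \<epsilon>\<close> and a change of the
    initial point at most \<open>C * \<epsilon>\<close>. The bound 1 keeps \<open>y\<close> in the
    ball on which \<open>C\<close> is valid, and the summand 1 makes the denominator
    positive.\<close>
  define \<epsilon> where "\<epsilon> = min 1 (r / (2 * (B + C + 1)))"
  have "0 < \<epsilon>"
    using \<open>0 < r\<close> \<open>0 < C\<close> B_nonneg by (simp add: \<epsilon>_def)
  have small: "(B + C) * \<epsilon> < r"
  proof -
    have K: "0 < B + C + 1" using \<open>0 < C\<close> B_nonneg by simp
    have "(B + C) * \<epsilon> \<le> (B + C + 1) * (r / (2 * (B + C + 1)))"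
      using \<open>0 < \<epsilon>\<close> \<open>0 < C\<close> B_nonneg by (intro mult_mono) (auto simp: \<epsilon>_def)
    also have "\<dots> = r / 2"
      using K by (simp del: distrib_left_numeral)
    finally show ?thesis using \<open>0 < r\<close> by linarith
  qed
  have "flow (F i) t y \<in> U" if y: "y \<in> ball x \<epsilon>" and t: "t \<in> {max 0 (u - \<epsilon>)..u + \<epsilon>}" for y t
  proof -
    let ?v = "const_control m i"
    have v: "?v \<in> controls m" using \<open>i \<le> m\<close> by (rule const_controls)
    have "0 \<le> t" using t by auto
    have "norm y \<le> norm x + norm (x - y)"
      by (metis norm_minus_commute norm_triangle_sub)
    then have yb: "y \<in> cball 0 (norm x + 1)"
      using y by (auto simp: dist_norm \<epsilon>_def)
    have "norm (phi m F t y ?v - phi m F u y ?v) \<le> B * \<bar>t - u\<bar>"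
      by (rule phi_time_lipschitz[OF v \<open>0 \<le> u\<close> \<open>0 \<le> t\<close>])
    also have "\<dots> \<le> B * \<epsilon>"
      using t B_nonneg by (intro mult_left_mono) auto
    finally have 1: "norm (phi m F t y ?v - phi m F u y ?v) \<le> B * \<epsilon>" .
    have "norm (phi m F u y ?v - phi m F u x ?v) \<le> C * norm (y - x)"
      by (rule C[OF yb _ v]) auto
    also have "\<dots> \<le> C * \<epsilon>"
      using y \<open>0 < C\<close> by (intro mult_left_mono) (auto simp: dist_norm norm_minus_commute)
    finally have 2: "norm (phi m F u y ?v - phi m F u x ?v) \<le> C * \<epsilon>" .
    have "norm (phi m F t y ?v - phi m F u x ?v) \<le> B * \<epsilon> + C * \<epsilon>"
      using norm_triangle_le[OF add_mono[OF 1 2]] by simp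
    then have "norm (flow (F i) t y - flow (F i) u x) < r"
      using small \<open>0 \<le> t\<close> \<open>0 \<le> u\<close> \<open>i \<le> m\<close> by (simp add: flow_eq_phi distrib_right)
    then show ?thesis
      using r by (auto simp: dist_norm norm_minus_commute)
  qed
  then show ?thesis using \<open>0 < \<epsilon>\<close> by blast
qed

text \<open>The given neighbourhood of \<open>(flow (F i) u x, j)\<close> is reached in one step with positive probability
  from a whole neighbourhood of \<open>(x, i)\<close>. Starting outside \<open>K\<close> one also ends up outside
  \<open>K\<close>, where that neighbourhood has no mass.\<close>

lemma locally_null_outside_step:
  assumes K: "closed K" "\<And>i t x. i \<le> m \<Longrightarrow> 0 \<le> t \<Longrightarrow> x \<in> K \<Longrightarrow> flow (F i) t x \<in> K"
    and ij: "i \<le> m" "j \<le> m" and "0 \<le> u" and Qpos: "0 < Q (flow (F i) u x) i j"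
    and good: "locally_null_outside K (flow (F i) u x, j)"
  shows "locally_null_outside K (x, i)"
proof -
  obtain V' where V': "open V'" "(flow (F i) u x, j) \<in> V'"
    and null: "prob {\<omega>\<in>space P. Z 0 \<omega> \<in> V' - K \<times> UNIV} = 0"
    using good by (auto simp: locally_null_outside_def)
  \<comment> \<open>Arriving in \<open>U\<close> makes mark \<open>j\<close> possible, and drawing
    it puts the new state into \<open>V'\<close>.\<close>
  define U where "U = (\<lambda>y. (y, j)) -` V' \<inter> (\<lambda>y. Q y i j) -` {0<..}"
  have "open U"
    unfolding U_def using V'(1) continuous_Q[OF ij]
    by (intro open_Int open_vimage continuous_intros) auto
  moreover have "flow (F i) u x \<in> U"
    using V'(2) Qpos by (simp add: U_def)
  ultimately obtain \<epsilon> where "0 < \<epsilon>"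
    and \<epsilon>: "\<And>y t. y \<in> ball x \<epsilon> \<Longrightarrow> t \<in> {max 0 (u - \<epsilon>)..u + \<epsilon>} \<Longrightarrow> flow (F i) t y \<in> U"
    using flow_jointly_continuous[OF ij(1) \<open>0 \<le> u\<close>, of U x] by blast
  \<comment> \<open>Marks carry the discrete topology, so the mark can be fixed in an open
    set.\<close>
  define V where "V = ball x \<epsilon> \<times> {i}"
  have "open V" unfolding V_def by (intro open_Times open_ball) (rule discrete_topology_class.open_discrete)
  define S where "S = V - K \<times> UNIV"
  have KU: "closed (K \<times> (UNIV :: nat set))" using K(1) by (intro closed_Times) auto
  then have S: "S \<in> sets borel" "V' - K \<times> UNIV \<in> sets borel"
    using \<open>open V\<close> V'(1) by (auto simp: S_def)
  \<comment> \<open>No jump before \<open>a\<close> and a jump by \<open>b\<close> place the first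
    holding time in a window around \<open>u\<close>. The truncation at 0 leaves a window of
    positive length even for \<open>u = 0\<close>.\<close>
  define a b where "a = max 0 (u - \<epsilon>)" and "b = u + \<epsilon>"
  have ab: "0 \<le> a" "0 \<le> b" "a < b"
    using \<open>0 \<le> u\<close> \<open>0 < \<epsilon>\<close> by (auto simp: a_def b_def)
  define G where "G = {\<omega>\<in>space P. Z 0 \<omega> \<in> S \<and> N a \<omega> = 0 \<and> 1 \<le> N b \<omega>}"
  have GF: "G \<in> sets (past_algebra m M P N Z 0)"
    unfolding G_def by (rule past_event[OF S(1) ab(1,2)])
  have GP: "G \<in> events"
    using GF past_subalgebra by (auto simp: subalgebra_def)
  have X1: "AE \<omega> in P. \<omega> \<in> G \<longrightarrow> fst (Z 1 \<omega>) \<in> U \<and> snd (Z 0 \<omega>) = i"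
    using AE_X1
  proof (rule AE_mp, intro AE_I2 impI)
    fix \<omega> assume "\<omega> \<in> space P" "\<omega> \<in> G" and eq: "0 \<le> interjump_time N 1 \<omega> \<and>
      fst (Z 1 \<omega>) = flow (F (snd (Z 0 \<omega>))) (interjump_time N 1 \<omega>) (fst (Z 0 \<omega>))"
    have "interjump_time N 1 \<omega> \<in> {a..b}"
      using interjump_time_1_bounds[OF P_poisson \<open>\<omega> \<in> space P\<close> ab(1,2)] \<open>\<omega> \<in> G\<close> by (auto simp: G_def)
    moreover have "fst (Z 0 \<omega>) \<in> ball x \<epsilon>" "snd (Z 0 \<omega>) = i"
      using \<open>\<omega> \<in> G\<close> by (auto simp: G_def S_def V_def mem_Times_iff)
    ultimately show "fst (Z 1 \<omega>) \<in> U \<and> snd (Z 0 \<omega>) = i"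
      using \<epsilon> eq by (auto simp: a_def b_def)
  qed
  have backward: "AE \<omega> in P. fst (Z 1 \<omega>) \<in> K \<longrightarrow> fst (Z 0 \<omega>) \<in> K"
    by (rule AE_absorbing_backward[OF K(1)]) (rule K(2))
  have "prob {\<omega>\<in>G. snd (Z 1 \<omega>) = j} \<le> prob {\<omega>\<in>space P. Z 1 \<omega> \<in> V' - K \<times> UNIV}"
  proof (rule finite_measure_mono_AE)
    show "AE \<omega> in P. \<omega> \<in> {\<omega>\<in>G. snd (Z 1 \<omega>) = j} \<longrightarrow> \<omega> \<in> {\<omega>\<in>space P. Z 1 \<omega> \<in> V' - K \<times> UNIV}"
      using X1 backward
      by eventually_elim (auto simp: G_def S_def U_def mem_Times_iff)
  qed (rule Z_event[OF S(2)])
  also have "\<dots> = 0"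
    using null prob_Z_stationary[OF S(2), of 1 0] by simp
  finally have mark_null: "prob {\<omega>\<in>G. snd (Z 1 \<omega>) = j} = 0"
    using measure_nonneg[of P "{\<omega>\<in>G. snd (Z 1 \<omega>) = j}"] by linarith
  have "AE \<omega> in P. \<omega> \<in> G \<longrightarrow> 0 < Q (fst (Z 1 \<omega>)) (snd (Z 0 \<omega>)) j"
    using X1
  proof eventually_elim
    fix \<omega> assume "\<omega> \<in> G \<longrightarrow> fst (Z 1 \<omega>) \<in> U \<and> snd (Z 0 \<omega>) = i"
    then show "\<omega> \<in> G \<longrightarrow> 0 < Q (fst (Z 1 \<omega>)) (snd (Z 0 \<omega>)) j"
      unfolding U_def by blast
  qed
  then have "prob G = 0"
    by (rule AE_mark_positive[OF GF ij(2) mark_null])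
  \<comment> \<open>By independence the probability of \<open>G\<close> is a product whose jump
    factor is positive, so the factor belonging to the initial state vanishes.\<close>
  then have "prob {\<omega>\<in>space P. Z 0 \<omega> \<in> S} = 0"
    using poisson_process_prob_first_jump[OF prob_space_axioms P_poisson rate_pos ab(1,3)]
    unfolding G_def prob_start_and_first_jump[OF S(1) ab(1,2)] by simp
  then show ?thesis
    using \<open>open V\<close> \<open>0 < \<epsilon>\<close> unfolding locally_null_outside_def S_def by (intro exI[of _ V]) (auto simp: V_def)
qed

text \<open>The backward step with \<open>u = 0\<close> changes the mark at an unchanged point. A
  positive entry of a power of \<open>Q x\<close> supplies marks leading from \<open>i\<close> to
  \<open>j\<close>, along which the property is carried back from \<open>j\<close> to
  \<open>i\<close>.\<close>

lemma locally_null_outside_all_marks: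
  assumes K: "closed K" "\<And>i t x. i \<le> m \<Longrightarrow> 0 \<le> t \<Longrightarrow> x \<in> K \<Longrightarrow> flow (F i) t x \<in> K"
    and "j \<le> m" "locally_null_outside K (x, j)" "i \<le> m"
  shows "locally_null_outside K (x, i)"
proof -
  obtain n where n: "0 < matrix_power m (Q x) n i j"
    using irreducible_Q[of x] assms(3,5) unfolding irreducible_aperiodic_def by blast
  from n \<open>j \<le> m\<close> \<open>locally_null_outside K (x, j)\<close> show ?thesis
  proof (induction n arbitrary: j)
    case 0
    then show ?case by (simp split: if_splits)
  next
    case (Suc n)
    obtain k where k: "k \<le> m" "0 < matrix_power m (Q x) n i k" "0 < Q x k j"
      using matrix_power_Suc_posD[OF transition_Q \<open>i \<le> m\<close> Suc.prems(2,1)] by blast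
    have "flow (F k) 0 x = x"
      using k(1) by (simp add: flow_eq_phi const_controls)
    then have "locally_null_outside K (x, k)"
      using locally_null_outside_step[OF K k(1) Suc.prems(2) order_refl, of x] k(3) Suc.prems(3) by simp
    then show ?case
      using Suc.IH k by blast
  qed
qed

lemma everywhere_locally_null_outside:
  assumes ics: "\<And>C. C \<in> invariant_control_sets_in m F M \<Longrightarrow> C \<subseteq> K \<and> interior C \<noteq> {}"
    and K: "closed K" "\<And>i t x. i \<le> m \<Longrightarrow> 0 \<le> t \<Longrightarrow> x \<in> K \<Longrightarrow> flow (F i) t x \<in> K"
    and "x \<in> M" "i \<le> m"
  shows "locally_null_outside K (x, i)"
proof -
  \<comment> \<open>An intersection over finitely many marks keeps \<open>H\<close> open, and
    \<open>H\<close> consists of points rather than states, as the control system requires.\<close>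
  define H where "H = (\<Inter>i\<in>{..m}. (\<lambda>x. (x, i)) -` {z. locally_null_outside K z})"
  have "open H"
    unfolding H_def by (intro open_INT ballI open_vimage open_locally_null_outside continuous_intros) auto
  have step: "y \<in> H" if "flow (F i) t y \<in> H" "i \<le> m" "0 \<le> t" for i t y
  proof -
    obtain j where j: "j \<le> m" "0 < Q (flow (F i) t y) i j"
      using transition_matrix_row_pos[OF transition_Q \<open>i \<le> m\<close>] by blast
    have "locally_null_outside K (y, i)"
      using locally_null_outside_step[OF K that(2) j(1) that(3) j(2)] that(1) j(1) by (auto simp: H_def)
    then show ?thesis
      using locally_null_outside_all_marks[OF K that(2)] by (auto simp: H_def)
  qed
  have comp: "compact (M - H)"
    using compact_M \<open>open H\<close> by (rule compact_diff)
  have "phi m F t y v \<in> M - H" if "y \<in> M - H" "0 \<le> t" "v \<in> controls m" for t y v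
    using flow_invariant_imp_phi_invariant[OF compact_imp_closed[OF comp] _ that(1,3,2)] flow_in_M step by blast
  then have "positively_invariant m F (M - H)"
    by (auto simp: positively_invariant_def)
  moreover have "\<not> C \<subseteq> M - H" if "invariant_control_set m F C" for C
  proof
    assume sub: "C \<subseteq> M - H"
    then have C: "C \<subseteq> K" "interior C \<noteq> {}"
      using ics[of C] that by (auto simp: invariant_control_sets_in_def)
    then obtain y where y: "y \<in> interior C" by blast
    \<comment> \<open>Since \<open>C\<close> lies in \<open>K\<close>, its interior times all marks
      is a neighbourhood with nothing outside \<open>K\<close>, irrespective of the measure.\<close>
    have empty: "interior C \<times> (UNIV :: nat set) - K \<times> UNIV = {}"
      using C(1) interior_subset by blast
    have "prob {\<omega>\<in>space P. Z 0 \<omega> \<in> interior C \<times> UNIV - K \<times> UNIV} = 0"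
      unfolding empty by simp
    moreover have "open (interior C \<times> (UNIV :: nat set))"
      by (intro open_Times) auto
    ultimately have "locally_null_outside K (y, i)" for i
      using y unfolding locally_null_outside_def by (intro exI[of _ "interior C \<times> UNIV"]) blast
    then have "y \<in> H" by (simp add: H_def)
    then show False
      using y sub interior_subset by blast
  qed
  ultimately have "M - H = {}"
    using exists_invariant_control_set[OF comp] by blast
  then show ?thesis
    using \<open>x \<in> M\<close> \<open>i \<le> m\<close> by (auto simp: H_def)
qed

lemma supp_subset:
  assumes ics: "\<And>C. C \<in> invariant_control_sets_in m F M \<Longrightarrow> C \<subseteq> K \<and> interior C \<noteq> {}"
    and K: "closed K" "\<And>i t x. i \<le> m \<Longrightarrow> 0 \<le> t \<Longrightarrow> x \<in> K \<Longrightarrow> flow (F i) t x \<in> K"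
  shows "supp \<mu> \<subseteq> K \<times> {..m}"
proof
  fix z assume z: "z \<in> supp \<mu>"
  then have zM: "z \<in> M \<times> {..m}"
    by (simp add: supp_def space_\<mu>)
  then have "locally_null_outside K z"
    using everywhere_locally_null_outside[OF ics K, of "fst z" "snd z"] by auto
  then obtain V where V: "open V" "z \<in> V" "prob {\<omega>\<in>space P. Z 0 \<omega> \<in> V - K \<times> UNIV} = 0"
    by (auto simp: locally_null_outside_def)
  have KU: "closed (K \<times> (UNIV :: nat set))" using K(1) by (intro closed_Times) auto
  \<comment> \<open>As \<open>K\<close> is closed, removing it from \<open>V\<close> leaves an open
    set; a null open set cannot contain a support point.\<close>
  then have op: "open (V - K \<times> UNIV)" using V(1) by (rule open_Diff[rotated])
  interpret \<mu>: prob_space \<mu>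
    using prob_space_distr[OF Z_measurable] distr_Z by metis
  have "emeasure \<mu> ((V - K \<times> UNIV) \<inter> space \<mu>) = 0"
    using V(3) prob_Z[of "V - K \<times> UNIV" 0] op by (simp add: \<mu>.emeasure_eq_measure space_\<mu>)
  then have "z \<notin> V - K \<times> UNIV"
    using z op by (auto simp: supp_def)
  then show "z \<in> K \<times> {..m}"
    using V(2) zM by (auto simp: mem_Times_iff)
qed

end

section \<open>Smooth vector fields\<close>

lemma C_infinity_lipschitz_on_cball:
  fixes f :: "'a::euclidean_space \<Rightarrow> 'a"
  assumes "C_infinity f"
  shows "\<exists>L>0. \<forall>y\<in>cball 0 r. \<forall>z\<in>cball 0 r. norm (f y - f z) \<le> L * norm (y - z)"
proof -
  have "C_k (Suc 0) f" using assms by (simp only: C_infinity_def)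
  then have diff: "\<And>x. f differentiable (at x)"
    and cont: "\<And>h. continuous_on UNIV (\<lambda>x. frechet_derivative f (at x) h)"
    by auto
  \<comment> \<open>The sum of the norms of the partial derivatives dominates the operator norm of
    the derivative and is continuous, hence bounded on the ball; convexity of the ball then gives
    the Lipschitz bound.\<close>
  define D where "D x = (\<Sum>b\<in>Basis. norm (frechet_derivative f (at x) b))" for x
  have "continuous_on (cball 0 r) D"
    unfolding D_def using cont by (intro continuous_intros) (auto intro: continuous_on_subset)
  then have "bounded (D ` cball 0 r)"
    by (intro compact_imp_bounded compact_continuous_image) auto
  then obtain L where "0 < L" and L: "\<And>x. x \<in> cball 0 r \<Longrightarrow> norm (D x) \<le> L"
    by (auto simp: bounded_pos)
  have "norm (f y - f z) \<le> L * norm (y - z)" if "y \<in> cball 0 r" "z \<in> cball 0 r" for y z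
  proof (rule differentiable_bound[of "cball 0 r"])
    fix x :: 'a assume x: "x \<in> cball 0 r"
    let ?f' = "frechet_derivative f (at x)"
    show "(f has_derivative ?f') (at x within cball 0 r)"
      using diff[of x] by (simp add: frechet_derivative_works has_derivative_at_withinI)
    have lin: "bounded_linear ?f'"
      using diff[of x] by (simp add: frechet_derivative_works has_derivative_bounded_linear)
    show "onorm ?f' \<le> L"
    proof (rule onorm_le)
      fix h :: 'a
      interpret bounded_linear ?f' by fact
      have "?f' h = (\<Sum>b\<in>Basis. (h \<bullet> b) *\<^sub>R ?f' b)"
        by (subst euclidean_representation[of h, symmetric]) (simp only: sum scaleR)
      also have "norm \<dots> \<le> (\<Sum>b\<in>Basis. norm h * norm (?f' b))"
        by (intro sum_norm_le) (auto intro!: mult_right_mono Basis_le_norm)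
      also have "\<dots> = norm h * D x"
        by (simp add: D_def sum_distrib_left)
      also have "\<dots> \<le> L * norm h"
        using L[OF x] by (subst mult.commute) (intro mult_right_mono, auto)
      finally show "norm (?f' h) \<le> L * norm h" .
    qed
  qed (use that in auto)
  then show ?thesis using \<open>0 < L\<close> by blast
qed

lemma bounded_fields_of_smooth:
  fixes F :: "nat \<Rightarrow> 'a \<Rightarrow> 'a::euclidean_space"
  assumes smooth: "\<And>i. i \<le> m \<Longrightarrow> C_infinity (F i)" and bdd: "\<And>i. i \<le> m \<Longrightarrow> bounded (range (F i))"
  shows "\<exists>B. bounded_fields m F B"
proof -
  have "bounded (\<Union>i\<in>{..m}. range (F i))"
    using bdd by (intro bounded_UN) auto
  then obtain B where B: "\<And>i y. i \<le> m \<Longrightarrow> norm (F i y) \<le> B"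
    by (auto simp: bounded_iff)
  have "\<exists>L>0. \<forall>i\<le>m. \<forall>y\<in>cball 0 r. \<forall>z\<in>cball 0 r. norm (F i y - F i z) \<le> L * norm (y - z)" for r
  proof -
    obtain L where L: "\<And>i. i \<le> m \<Longrightarrow> 0 < L i"
      "\<And>i y z. i \<le> m \<Longrightarrow> y \<in> cball 0 r \<Longrightarrow> z \<in> cball 0 r \<Longrightarrow> norm (F i y - F i z) \<le> L i * norm (y - z)"
      using C_infinity_lipschitz_on_cball[OF smooth, of _ r] by metis
    have "norm (F i y - F i z) \<le> (\<Sum>i\<le>m. L i) * norm (y - z)"
      if "i \<le> m" "y \<in> cball 0 r" "z \<in> cball 0 r" for i y z
    proof -
      have "L i \<le> (\<Sum>i\<le>m. L i)"
        using L(1) that(1) by (intro member_le_sum) (auto intro: less_imp_le)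
      then show ?thesis
        using L(2)[OF that] by (meson mult_right_mono norm_ge_zero order_trans)
    qed
    moreover have "0 < (\<Sum>i\<le>m. L i)"
      using L(1) by (intro sum_pos) auto
    ultimately show ?thesis by blast
  qed
  then show ?thesis
    using B unfolding bounded_fields_def by blast
qed

theorem theorem4p5:
  fixes m :: nat
    and F :: "nat \<Rightarrow> 'a \<Rightarrow> 'a::euclidean_space"
    and M :: "'a set"
    and Q :: "'a \<Rightarrow> nat \<Rightarrow> nat \<Rightarrow> real"
    and rate :: real
  assumes "\<And>i. i \<le> m \<Longrightarrow> C_infinity (F i)"
    and "\<And>i. i \<le> m \<Longrightarrow> bounded (range (F i))"
    and "M \<noteq> {}" and "compact M" and "positively_invariant m F M"
    and "\<And>i j. i \<le> m \<Longrightarrow> j \<le> m \<Longrightarrow> continuous_on UNIV (\<lambda>x. Q x i j)"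
    and "\<And>x. transition_matrix m (Q x)"
    and "\<And>x. irreducible_aperiodic m (Q x)"
    and "0 < rate"
  shows
    "(finite (invariant_control_sets_in m F M) \<and>
      (\<forall>C \<in> invariant_control_sets_in m F M.
         C = closure (interior C) \<and> (\<forall>x\<in>C. interior C \<subseteq> orbit_pos m F x)) \<longrightarrow>
      (\<forall>\<mu> (P :: 'w measure) N Z. invariant_measure m F Q rate M P N Z \<mu> \<longrightarrow>
         supp \<mu> \<subseteq> (\<Union>C \<in> invariant_control_sets_in m F M. C \<times> {..m}))) \<and>
     (locally_accessible_on m F M \<longrightarrow>
      finite (invariant_control_sets_in m F M) \<and>
      (\<forall>C \<in> invariant_control_sets_in m F M.
         C = closure (interior C) \<and> (\<forall>x\<in>C. interior C \<subseteq> orbit_pos m F x)))"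
proof -
  obtain B where "bounded_fields m F B"
    using bounded_fields_of_smooth[of m F] assms(1,2) by blast
  then interpret bounded_fields m F B .
  let ?I = "invariant_control_sets_in m F M"
  have supp: "supp \<mu> \<subseteq> (\<Union>C\<in>?I. C \<times> {..m})"
    if "finite ?I" and reg: "\<And>C. C \<in> ?I \<Longrightarrow> C = closure (interior C)"
      and inv: "invariant_measure m F Q rate M P N Z \<mu>" for \<mu> and P :: "'w measure" and N Z
  proof -
    interpret stationary_switching_chain m F B M Q rate P N Z \<mu>
      using assms inv by unfold_locales auto
    have clo: "closed C" if "C \<in> ?I" for C
      using reg[OF that] by (metis closed_closure)
    \<comment> \<open>The absorbing set is the union of the invariant control sets: closed as a
      finite union of closed sets, and kept by each flow because orbits do not leave a closed
      invariant control set.\<close>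
    have "supp \<mu> \<subseteq> \<Union>?I \<times> {..m}"
    proof (rule supp_subset)
      fix C assume C: "C \<in> ?I"
      then have "C \<noteq> {}"
        by (auto simp: invariant_control_sets_in_def invariant_control_set_def control_set_def)
      then show "C \<subseteq> \<Union>?I \<and> interior C \<noteq> {}"
        using C reg[OF C] by auto
    next
      show "closed (\<Union>?I)"
        using \<open>finite ?I\<close> clo by (intro closed_Union) auto
    next
      fix i and t :: real and x assume "i \<le> m" "0 \<le> t" "x \<in> \<Union>?I"
      then obtain C where C: "C \<in> ?I" "x \<in> C" by blast
      then have "orbit_pos m F x \<subseteq> C"
        using orbit_pos_subset_closed_invariant_control_set clo by (auto simp: invariant_control_sets_in_def)
      moreover have "flow (F i) t x \<in> orbit_pos m F x"
        using \<open>i \<le> m\<close> \<open>0 \<le> t\<close> by (auto simp: mem_orbit_pos_iff flow_eq_phi intro: const_controls)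
      ultimately show "flow (F i) t x \<in> \<Union>?I"
        using C by blast
    qed
    then show ?thesis by auto
  qed
  have regular: "C = closure (interior C) \<and> (\<forall>x\<in>C. interior C \<subseteq> orbit_pos m F x)"
    if "locally_accessible_on m F M" "C \<in> ?I" for C
  proof -
    have "invariant_control_set m F C" "C \<subseteq> M"
      using that(2) by (auto simp: invariant_control_sets_in_def)
    note C = accessible_invariant_control_set[OF that(1) compact_imp_closed[OF assms(4)] this]
    show ?thesis
      using C(1) by (rule conjI) (use C(2) in blast)
  qed
  show ?thesis
  proof (intro conjI impI)
    assume *: "finite ?I \<and> (\<forall>C\<in>?I. C = closure (interior C) \<and> (\<forall>x\<in>C. interior C \<subseteq> orbit_pos m F x))"
    show "\<forall>\<mu> (P :: 'w measure) N Z. invariant_measure m F Q rate M P N Z \<mu> \<longrightarrow>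
        supp \<mu> \<subseteq> (\<Union>C\<in>?I. C \<times> {..m})"
      using * by (intro allI impI supp) auto
  next
    assume acc: "locally_accessible_on m F M"
    show "finite ?I"
      by (rule accessible_finite_invariant_control_sets[OF acc assms(4,5)])
    show "\<forall>C\<in>?I. C = closure (interior C) \<and> (\<forall>x\<in>C. interior C \<subseteq> orbit_pos m F x)"
      using regular[OF acc] by blast
  qed
qed

end
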